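(* Let $(X,\sigma_X)$ be an irreducible (one-step) shift of finite type, $(Y,\sigma_Y)$ a subshift and $\pi:X\to Y$ a one-block factor map. Suppose there exists $\mu$ such that $\mu$ is an invariant weak Gibbs measure for $f\in C(X)$. Let $g_n$ be the functions on $Y$ associated to $f$ and $\pi$ as in the context. If there is no sequence $\{C_{n,m}\}_{n,m\in\mathbb N}$ such that $$\frac1{C_{n,m}}\le\frac{g_{n+m}(y)}{g_n(y)g_m(\sigma_Y^ny)}\le C_{n,m}\ \text{ for all }y\in Y,\ n,m\in\mathbb N,\quad\text{where }\lim_{n\to\infty}\frac1n\log C_{n,m}=\lim_{m\to\infty}\frac1m\log C_{n,m}=0,$$ then there does not exist a continuous function $h$ on $Y$ such that $\lim_{n\to\infty}\frac1n\int\log g_n\,dm=\int h\,dm$ for every $m\in M(Y,\sigma_Y)$. Hence there exists no continuous function on $Y$ for which $\pi\mu$ is an invariant weak Gibbs measure on $Y$.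
   Context: $\mathbb N=\{1,2,\dots\}$. A (one-sided) subshift $(X,\sigma_X)$ is a closed set $X\subseteq\{1,\dots,k\}^{\mathbb N}$ (some $k\ge1$) with $\sigma_X(X)\subseteq X$, where $(\sigma_Xx)_i=x_{i+1}$. $B_n(X)$ is the set of words of length $n$ appearing in points of $X$, $B_0(X)=\{\epsilon\}$ (empty word), $B(X)=\bigcup_{n\ge0}B_n(X)$. The cylinder $[x_1\dots x_n]$ is the set of $z\in X$ with $z_i=x_i$ for $1\le i\le n$. $X$ is irreducible if for all $u,v\in B(X)$ there is $w\in B(X)$ with $uwv\in B(X)$. Shifts of finite type are one-step: $X$ is the set of all sequences in $\{1,\dots,k\}^{\mathbb N}$ in which no word of a given set of forbidden blocks of length $\le2$ appears. $M(X,\sigma_X)$ is the set of $\sigma_X$-invariant Borel probability measures; $(S_nf)(x)=\sum_{i=0}^{n-1}f(\sigma_X^ix)$. A factor map $\pi:X\to Y$ is a continuous surjection with $\pi\circ\sigma_X=\sigma_Y\circ\pi$; it is one-block if $\pi(x)_i$ depends only on $x_i$, so $\pi$ acts on words. $\pi\mu$ is the push-forward measure $\mu\circ\pi^{-1}$. The functions $g_n$: for $y\in Y$ let $E_n(y)$ denote a set consisting of exactly one point from each cylinder $[x_1\dots x_n]$ in $X$ such that $\pi(x_1\dots x_n)=y_1\dots y_n$; set $g_n(y)=\sup_{E_n(y)}\sum_{x\in E_n(y)}e^{(S_nf)(x)}$, the supremum over all such choices $E_n(y)$. For a continuous function $f$ on a subshift $X$, its topological pressure is $P(f)=\limsup_{n\to\infty}\frac1n\log\sum_{u\in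 B_n(X)}\sup\{e^{(S_nf)(x)}:x\in[u]\}$. A measure $\mu\in M(X,\sigma_X)$ is an (invariant) weak Gibbs measure for $f$ if there are $C_n>0$ with $\lim_{n\to\infty}\frac1n\log C_n=0$ and $\frac1{C_n}<\frac{\mu[x_1\dots x_n]}{e^{-nP(f)+(S_nf)(x)}}<C_n$ for every $x\in X$, $n\in\mathbb N$. *)

theory Defs
  imports "HOL-Probability.Probability"
begin

text \<open>
  A sequence \<open>x\<^sub>1 x\<^sub>2 \<dots>\<close> over \<open>{1..k}\<close> is a function \<open>x :: nat \<Rightarrow> nat\<close> whose value at \<open>i\<close> is the
  symbol with index \<open>i + 1\<close>.  The topology on \<open>nat \<Rightarrow> nat\<close> is the library's product topology over
  the discrete space \<open>nat\<close>, so on sequences over \<open>{1..k}\<close> it is the usual compact one.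
\<close>

definition left_shift :: "(nat \<Rightarrow> nat) \<Rightarrow> nat \<Rightarrow> nat" where
  "left_shift x = (\<lambda>i. x (Suc i))"

definition full_shift :: "nat \<Rightarrow> (nat \<Rightarrow> nat) set" where
  "full_shift k = {x. \<forall>i. x i \<in> {1..k}}"

definition subshift :: "nat \<Rightarrow> (nat \<Rightarrow> nat) set \<Rightarrow> bool" where
  "subshift k X \<longleftrightarrow> 1 \<le> k \<and> X \<subseteq> full_shift k \<and> closed X \<and> left_shift ` X \<subseteq> X"

definition subword :: "(nat \<Rightarrow> nat) \<Rightarrow> nat \<Rightarrow> nat \<Rightarrow> nat list" where
  "subword x i n = map x [i..<i + n]"

definition prefix_word :: "nat \<Rightarrow> (nat \<Rightarrow> nat) \<Rightarrow> nat list" where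
  "prefix_word n x = subword x 0 n"

text \<open>The case distinction only matters for empty \<open>X\<close>, where \<open>B\<^sub>0\<close> still contains the empty word.\<close>

definition words_of_length :: "(nat \<Rightarrow> nat) set \<Rightarrow> nat \<Rightarrow> nat list set" where
  "words_of_length X n = (if n = 0 then {[]} else {subword x i n | x i. x \<in> X})"

definition language :: "(nat \<Rightarrow> nat) set \<Rightarrow> nat list set" where
  "language X = (\<Union>n. words_of_length X n)"

definition cylinder :: "(nat \<Rightarrow> nat) set \<Rightarrow> nat list \<Rightarrow> (nat \<Rightarrow> nat) set" where
  "cylinder X u = {z \<in> X. prefix_word (length u) z = u}"

definition irreducible_shift :: "(nat \<Rightarrow> nat) set \<Rightarrow> bool" where
  "irreducible_shift X \<longleftrightarrow>
     (\<forall>u \<in> language X. \<forall>v \<in> language X. \<exists>w \<in> language X. u @ w @ v \<in> language X)"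

definition one_step_sft :: "nat \<Rightarrow> (nat \<Rightarrow> nat) set \<Rightarrow> bool" where
  "one_step_sft k X \<longleftrightarrow> subshift k X \<and>
     (\<exists>F. (\<forall>w \<in> F. length w \<le> 2 \<and> set w \<subseteq> {1..k}) \<and>
          X = {x \<in> full_shift k. \<forall>i n. subword x i n \<notin> F})"

definition factor_map ::
  "(nat \<Rightarrow> nat) set \<Rightarrow> (nat \<Rightarrow> nat) set \<Rightarrow> ((nat \<Rightarrow> nat) \<Rightarrow> nat \<Rightarrow> nat) \<Rightarrow> bool" where
  "factor_map X Y \<pi> \<longleftrightarrow> continuous_on X \<pi> \<and> \<pi> ` X = Y \<and>
     (\<forall>x \<in> X. \<pi> (left_shift x) = left_shift (\<pi> x))"

text \<open>
  The symbol map \<open>\<Phi>\<close> induced by a one-block map \<open>\<pi>\<close> is determined by \<open>\<pi>\<close> on all symbols occurring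
  in \<open>X\<close>; \<open>\<pi>\<close> acts on words of \<open>X\<close> as \<open>map \<Phi>\<close>.
\<close>

definition one_block_map ::
  "(nat \<Rightarrow> nat) set \<Rightarrow> (nat \<Rightarrow> nat) \<Rightarrow> ((nat \<Rightarrow> nat) \<Rightarrow> nat \<Rightarrow> nat) \<Rightarrow> bool" where
  "one_block_map X \<Phi> \<pi> \<longleftrightarrow> (\<forall>x \<in> X. \<forall>i. \<pi> x i = \<Phi> (x i))"

definition birkhoff_sum :: "((nat \<Rightarrow> nat) \<Rightarrow> real) \<Rightarrow> nat \<Rightarrow> (nat \<Rightarrow> nat) \<Rightarrow> real" where
  "birkhoff_sum f n x = (\<Sum>i<n. f ((left_shift ^^ i) x))"

definition fibre_words ::
  "(nat \<Rightarrow> nat) set \<Rightarrow> (nat \<Rightarrow> nat) \<Rightarrow> nat \<Rightarrow> (nat \<Rightarrow> nat) \<Rightarrow> nat list set" where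
  "fibre_words X \<Phi> n y = {u \<in> words_of_length X n. map \<Phi> u = prefix_word n y}"

text \<open>The admissible choices of the set \<open>E\<^sub>n(y)\<close>.\<close>

definition fibre_selections ::
  "(nat \<Rightarrow> nat) set \<Rightarrow> (nat \<Rightarrow> nat) \<Rightarrow> nat \<Rightarrow> (nat \<Rightarrow> nat) \<Rightarrow> (nat \<Rightarrow> nat) set set" where
  "fibre_selections X \<Phi> n y =
     {E. E \<subseteq> (\<Union>u \<in> fibre_words X \<Phi> n y. cylinder X u) \<and>
         (\<forall>u \<in> fibre_words X \<Phi> n y. \<exists>!x. x \<in> E \<inter> cylinder X u)}"

definition fibre_sum ::
  "(nat \<Rightarrow> nat) set \<Rightarrow> (nat \<Rightarrow> nat) \<Rightarrow> ((nat \<Rightarrow> nat) \<Rightarrow> real) \<Rightarrow> nat \<Rightarrow> (nat \<Rightarrow> nat) \<Rightarrow> real" where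
  "fibre_sum X \<Phi> f n y =
     (SUP E \<in> fibre_selections X \<Phi> n y. \<Sum>x\<in>E. exp (birkhoff_sum f n x))"

definition invariant_measures :: "(nat \<Rightarrow> nat) set \<Rightarrow> (nat \<Rightarrow> nat) measure set" where
  "invariant_measures X =
     {\<mu>. prob_space \<mu> \<and> sets \<mu> = sets (restrict_space borel X) \<and> distr \<mu> \<mu> left_shift = \<mu>}"

text \<open>
  The upper limit is taken in \<^typ>\<open>ereal\<close>; for nonempty \<open>X\<close> and continuous \<open>f\<close> it is finite, so the
  conversion to \<^typ>\<open>real\<close> loses nothing.
\<close>

definition pressure :: "(nat \<Rightarrow> nat) set \<Rightarrow> ((nat \<Rightarrow> nat) \<Rightarrow> real) \<Rightarrow> real" where
  "pressure X f = real_of_ereal (limsup (\<lambda>n. ereal (1 / real n *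
     ln (\<Sum>u \<in> words_of_length X n. SUP x \<in> cylinder X u. exp (birkhoff_sum f n x)))))"

definition invariant_weak_gibbs ::
  "(nat \<Rightarrow> nat) set \<Rightarrow> ((nat \<Rightarrow> nat) \<Rightarrow> real) \<Rightarrow> (nat \<Rightarrow> nat) measure \<Rightarrow> bool" where
  "invariant_weak_gibbs X f \<mu> \<longleftrightarrow> \<mu> \<in> invariant_measures X \<and>
     (\<exists>C :: nat \<Rightarrow> real.
        (\<forall>n\<ge>1. C n > 0) \<and>
        (\<lambda>n. 1 / real n * ln (C n)) \<longlonglongrightarrow> 0 \<and>
        (\<forall>x \<in> X. \<forall>n\<ge>1.
           1 / C n < measure \<mu> (cylinder X (prefix_word n x)) /
                       exp (- real n * pressure X f + birkhoff_sum f n x) \<and>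
           measure \<mu> (cylinder X (prefix_word n x)) /
             exp (- real n * pressure X f + birkhoff_sum f n x) < C n))"

text \<open>
  The two limits are iterated, not joint: the first holds for each fixed \<open>m\<close>, the second for each
  fixed \<open>n\<close>.
\<close>

definition almost_multiplicative ::
  "(nat \<Rightarrow> nat) set \<Rightarrow> (nat \<Rightarrow> (nat \<Rightarrow> nat) \<Rightarrow> real) \<Rightarrow> (nat \<Rightarrow> nat \<Rightarrow> real) \<Rightarrow> bool" where
  "almost_multiplicative Y g C \<longleftrightarrow>
     (\<forall>n\<ge>1. \<forall>m\<ge>1. C n m > 0) \<and>
     (\<forall>y \<in> Y. \<forall>n\<ge>1. \<forall>m\<ge>1.
        1 / C n m \<le> g (n + m) y / (g n y * g m ((left_shift ^^ n) y)) \<and>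
        g (n + m) y / (g n y * g m ((left_shift ^^ n) y)) \<le> C n m) \<and>
     (\<forall>m\<ge>1. (\<lambda>n. 1 / real n * ln (C n m)) \<longlonglongrightarrow> 0) \<and>
     (\<forall>n\<ge>1. (\<lambda>m. 1 / real m * ln (C n m)) \<longlonglongrightarrow> 0)"

end

theory Submission
  imports Defs "HOL-Real_Asymp.Real_Asymp"
begin

text \<open>
  If \<open>log g\<^sub>n\<close> differs from the Birkhoff sums \<open>S\<^sub>n h\<close> of some function by at most \<open>e\<^sub>n = o(n)\<close>, uniformly
  on \<open>Y\<close>, then \<open>C\<^sub>n\<^sub>,\<^sub>m = exp (e\<^sub>n + e\<^sub>m + e\<^sub>n\<^sub>+\<^sub>m)\<close> makes \<open>g\<close> almost multiplicative.  When \<open>\<pi>\<mu>\<close> is weak Gibbs,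
  summing the Gibbs bounds of \<open>\<mu>\<close> over the preimages of a word yields such an estimate directly.

  When only the integrals of \<open>h\<close> are known, close up \<open>y\<^sub>1 \<dots> y\<^sub>n\<close> to a periodic point \<open>z\<close> of \<open>Y\<close> whose
  period \<open>L\<close> exceeds \<open>n\<close> by a bounded amount.  Concatenating preimages shows that \<open>g\<^sub>N\<^sub>L(z)\<close> is at least
  the \<open>N\<close>-th power of \<open>g\<^sub>n(y)\<close> up to a factor \<open>exp (o(n))\<close>, and submultiplicativity bounds it above by
  \<open>g\<^sub>L(z)\<^sup>N\<close>.  The hypothesis for the measure on the orbit of \<open>z\<close> then pins \<open>S\<^sub>L h(z)\<close>, hence \<open>S\<^sub>n h(y)\<close>, to
  \<open>log g\<^sub>n(y)\<close> up to \<open>o(n)\<close>.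
\<close>

section \<open>Words, shifts and Birkhoff sums on a subshift\<close>

lemma funpow_left_shift: "(left_shift ^^ n) x = (\<lambda>i. x (i + n))"
  by (induction n arbitrary: x) (auto simp: left_shift_def)

lemma length_prefix_word [simp]: "length (prefix_word n x) = n"
  by (simp add: prefix_word_def subword_def)

lemma nth_prefix_word [simp]: "i < n \<Longrightarrow> prefix_word n x ! i = x i"
  by (simp add: prefix_word_def subword_def)

lemma prefix_word_eq_iff: "prefix_word n x = prefix_word n x' \<longleftrightarrow> (\<forall>i<n. x i = x' i)"
  by (auto simp: list_eq_iff_nth_eq)

lemma subword_eq_prefix_word: "subword x i n = prefix_word n ((left_shift ^^ i) x)"
  by (rule nth_equalityI) (auto simp: prefix_word_def subword_def funpow_left_shift add.commute)

lemma prefix_word_add: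
  "prefix_word (n + m) x = prefix_word n x @ prefix_word m ((left_shift ^^ n) x)"
  by (rule nth_equalityI) (auto simp: nth_append funpow_left_shift)

lemma subshift_funpow: "subshift k X \<Longrightarrow> x \<in> X \<Longrightarrow> (left_shift ^^ n) x \<in> X"
  by (induction n) (auto simp: subshift_def)

lemma subshift_symbol: "subshift k X \<Longrightarrow> x \<in> X \<Longrightarrow> x i \<in> {1..k}"
  by (auto simp: subshift_def full_shift_def)

text \<open>Shift invariance turns an occurrence at any position into an occurrence at the start of
  another point. For empty \<open>X\<close> the equation fails at \<open>n = 0\<close>, where the
  empty word is still counted.\<close>

lemma words_of_length_eq_prefixes:
  assumes "subshift k X" "X \<noteq> {}"
  shows "words_of_length X n = prefix_word n ` X"
proof (cases "n = 0")
  case True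
  then show ?thesis using assms by (auto simp: words_of_length_def prefix_word_def subword_def)
next
  case False
  have "subword x i n \<in> prefix_word n ` X" if "x \<in> X" for x i
    using subshift_funpow[OF assms(1) that, of i] by (auto simp: subword_eq_prefix_word)
  moreover have "prefix_word n x = subword x 0 n" for x by (simp add: prefix_word_def)
  ultimately show ?thesis using False by (auto simp: words_of_length_def)
qed

lemma finite_words_of_length:
  assumes "subshift k X"
  shows "finite (words_of_length X n)" "card (words_of_length X n) \<le> k ^ n"
proof -
  let ?A = "{xs. set xs \<subseteq> {1..k} \<and> length xs = n}"
  have sub: "words_of_length X n \<subseteq> ?A"
    using subshift_symbol[OF assms] by (auto simp: words_of_length_def subword_def)
  have fin: "finite ?A" by (rule finite_lists_length_eq) simp
  show "finite (words_of_length X n)" using sub fin by (rule finite_subset)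
  show "card (words_of_length X n) \<le> k ^ n"
    using card_mono[OF fin sub]
    unfolding card_lists_length_eq[OF finite_atLeastAtMost] card_atLeastAtMost diff_Suc_1 .
qed

lemma compact_full_shift: "compact (full_shift k)"
proof -
  have "full_shift k = PiE UNIV (\<lambda>_. {1..k})" unfolding full_shift_def PiE_UNIV_domain by auto
  moreover have "compactin (product_topology (\<lambda>i::nat. euclidean) UNIV) (PiE UNIV (\<lambda>_. {1..k}))"
    unfolding compactin_PiE compactin_euclidean_iff by (intro disjI2 ballI finite_imp_compact) simp
  ultimately show ?thesis by (metis compactin_euclidean_iff euclidean_product_topology)
qed

lemma subshift_compact: "subshift k X \<Longrightarrow> compact X"
  by (metis Int_absorb1 compact_Int_closed compact_full_shift subshift_def)

lemma continuous_on_left_shift: "continuous_on A left_shift"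
  unfolding left_shift_def
  by (intro continuous_on_coordinatewise_then_product)
    (rule continuous_on_subset[OF continuous_on_product_coordinates subset_UNIV])

lemma continuous_on_birkhoff_sum:
  assumes "subshift k X" "continuous_on X f"
  shows "continuous_on X (birkhoff_sum f n)"
proof -
  have c: "continuous_on X (left_shift ^^ i)" for i
    unfolding funpow_left_shift[abs_def]
    by (intro continuous_on_coordinatewise_then_product)
      (rule continuous_on_subset[OF continuous_on_product_coordinates subset_UNIV])
  have "continuous_on X (\<lambda>x. f ((left_shift ^^ i) x))" for i
    by (rule continuous_on_compose2[OF assms(2) c]) (use subshift_funpow[OF assms(1)] in auto)
  then show ?thesis unfolding birkhoff_sum_def[abs_def] by (intro continuous_on_sum) auto
qed

lemma birkhoff_sum_add:
  "birkhoff_sum f (n + m) x = birkhoff_sum f n x + birkhoff_sum f m ((left_shift ^^ n) x)"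
proof -
  have "sum h {..<n + m} = sum h {..<n} + (\<Sum>i<m. h (i + n))" for h :: "nat \<Rightarrow> real"
    by (induction m) (auto simp: add.commute)
  then show ?thesis by (simp add: birkhoff_sum_def funpow_add)
qed

lemma birkhoff_sum_abs_le:
  assumes "subshift k X" "\<forall>x\<in>X. \<bar>f x\<bar> \<le> M" "x \<in> X"
  shows "\<bar>birkhoff_sum f n x\<bar> \<le> real n * M"
proof -
  have "\<bar>birkhoff_sum f n x\<bar> \<le> (\<Sum>i<n. \<bar>f ((left_shift ^^ i) x)\<bar>)"
    unfolding birkhoff_sum_def by (rule sum_abs)
  also have "\<dots> \<le> (\<Sum>i<n. M)"
    by (intro sum_mono) (use assms subshift_funpow in blast)
  finally show ?thesis by simp
qed

lemma subshift_bounded: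
  fixes f :: "(nat \<Rightarrow> nat) \<Rightarrow> real"
  assumes "subshift k X" "continuous_on X f"
  obtains M where "0 \<le> M" "\<forall>x\<in>X. \<bar>f x\<bar> \<le> M"
proof -
  have "bounded (f ` X)"
    using compact_continuous_image[OF assms(2) subshift_compact[OF assms(1)]] compact_imp_bounded by blast
  then obtain B where "\<forall>x\<in>X. \<bar>f x\<bar> \<le> B" by (auto simp: bounded_iff)
  then have "\<forall>x\<in>X. \<bar>f x\<bar> \<le> max 0 B" by force
  then show ?thesis using that[of "max 0 B"] by simp
qed

section \<open>Prefix cylinders, uniform continuity and sublinear distortion\<close>

lemma open_prefix: "open {z :: nat \<Rightarrow> nat. prefix_word n z = prefix_word n x}"
proof -
  have "open {z. \<forall>i\<in>{..<n}. z i \<in> {x i}}"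
    by (rule product_topology_basis') (simp_all add: Topological_Spaces.open_discrete)
  then show ?thesis by (simp add: prefix_word_eq_iff Ball_def)
qed

text \<open>Sequences with a different prefix are again covered by prefix sets, so the complement is
  a union of open sets.\<close>

lemma closed_prefix: "closed {z :: nat \<Rightarrow> nat. prefix_word n z = prefix_word n x}"
proof -
  have eq: "- {z. prefix_word n z = prefix_word n x} =
      (\<Union>x'\<in>- {z. prefix_word n z = prefix_word n x}. {z. prefix_word n z = prefix_word n x'})"
    by auto
  show ?thesis
    unfolding closed_def by (subst eq) (intro open_UN ballI open_prefix)
qed

lemma borel_prefix: "{z. prefix_word n z = u} \<in> sets borel"
proof (cases "\<exists>x. prefix_word n x = u")
  case True
  then show ?thesis using open_prefix by (metis borel_open)
next
  case False
  then have "{z. prefix_word n z = u} = {}" by auto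
  then show ?thesis by simp
qed

text \<open>A basic open set of the product topology constrains finitely many coordinates, so a
  prefix reaching beyond the last of them decides membership.\<close>

lemma open_contains_prefix:
  fixes U :: "(nat \<Rightarrow> nat) set"
  assumes "open U" "x \<in> U"
  obtains n where "\<And>z. prefix_word n z = prefix_word n x \<Longrightarrow> z \<in> U"
proof -
  have "openin (product_topology (\<lambda>_. euclidean) UNIV) U"
    unfolding euclidean_product_topology by (rule open_openin[THEN iffD1, OF assms(1)])
  from product_topology_open_contains_basis[OF this assms(2)]
  obtain W where W: "x \<in> Pi\<^sub>E UNIV W" "finite {i. W i \<noteq> UNIV}" "Pi\<^sub>E UNIV W \<subseteq> U"
    by auto
  \<comment> \<open>If no coordinate is constrained, \<open>Max\<close> is taken of the empty set
    and its value is arbitrary; every prefix length then works.\<close>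
  define n where "n = Suc (Max {i. W i \<noteq> UNIV})"
  have "z \<in> U" if "prefix_word n z = prefix_word n x" for z
  proof -
    have "z i \<in> W i" for i
    proof (cases "W i = UNIV")
      case False
      then have "i < n" unfolding n_def less_Suc_eq_le by (intro Max_ge W(2)) simp
      then show ?thesis using that W(1) by (auto simp: prefix_word_eq_iff PiE_UNIV_domain Pi_iff)
    qed simp
    then show ?thesis using W(3) by (auto simp: PiE_UNIV_domain)
  qed
  then show ?thesis using that by blast
qed

text \<open>Heine-Cantor for prefixes: compactness leaves finitely many of the pointwise prefix
  lengths, and two points near the same centre are near each other.\<close>

lemma uniformly_continuous_prefix:
  fixes f :: "(nat \<Rightarrow> nat) \<Rightarrow> real"
  assumes "subshift k X" "continuous_on X f" "0 < \<epsilon>"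
  obtains N where "\<forall>x\<in>X. \<forall>x'\<in>X. prefix_word N x = prefix_word N x' \<longrightarrow> \<bar>f x - f x'\<bar> < \<epsilon>"
proof -
  have "\<exists>n. \<forall>z\<in>X. prefix_word n z = prefix_word n x \<longrightarrow> \<bar>f z - f x\<bar> < \<epsilon> / 2" if "x \<in> X" for x
  proof -
    obtain A where A: "open A" "A \<inter> X = f -` ball (f x) (\<epsilon> / 2) \<inter> X"
      using assms(2)[unfolded continuous_on_open_invariant, rule_format, OF open_ball] by metis
    then have "x \<in> A" using that assms(3) by auto
    then obtain n where n: "\<And>z. prefix_word n z = prefix_word n x \<Longrightarrow> z \<in> A"
      using open_contains_prefix[OF A(1)] by blast
    have "\<bar>f z - f x\<bar> < \<epsilon> / 2" if "z \<in> X" "prefix_word n z = prefix_word n x" for z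
    proof -
      have "z \<in> f -` ball (f x) (\<epsilon> / 2)" using n[OF that(2)] that(1) A(2) by blast
      then show ?thesis by (simp add: dist_real_def abs_minus_commute)
    qed
    then show ?thesis by blast
  qed
  then obtain n where n:
    "\<And>x z. x \<in> X \<Longrightarrow> z \<in> X \<Longrightarrow> prefix_word (n x) z = prefix_word (n x) x \<Longrightarrow> \<bar>f z - f x\<bar> < \<epsilon> / 2"
    by metis
  obtain D where D: "D \<subseteq> X" "finite D" "X \<subseteq> (\<Union>x\<in>D. {z. prefix_word (n x) z = prefix_word (n x) x})"
    by (rule compactE_image[OF subshift_compact[OF assms(1)],
          of X "\<lambda>x. {z. prefix_word (n x) z = prefix_word (n x) x}"])
      (use open_prefix in auto)
  \<comment> \<open>The sum serves as an upper bound for all \<open>n x\<close> with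
    \<open>x\<close> in \<open>D\<close>, and it makes sense for empty \<open>D\<close> too.\<close>
  define N where "N = (\<Sum>x\<in>D. n x)"
  have "\<bar>f x - f x'\<bar> < \<epsilon>" if x: "x \<in> X" "x' \<in> X" and eq: "prefix_word N x = prefix_word N x'" for x x'
  proof -
    obtain d where d: "d \<in> D" "prefix_word (n d) x = prefix_word (n d) d" using D(3) x(1) by blast
    have "n d \<le> N" unfolding N_def using D(2) d(1) by (intro member_le_sum) auto
    then have "prefix_word (n d) x' = prefix_word (n d) d"
      using eq d(2) by (auto simp: prefix_word_eq_iff)
    moreover have "d \<in> X" using d(1) D(1) by blast
    ultimately have "\<bar>f x - f d\<bar> < \<epsilon> / 2" "\<bar>f x' - f d\<bar> < \<epsilon> / 2" using n x d(2) by blast+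
    then show ?thesis by linarith
  qed
  then show ?thesis using that by blast
qed

text \<open>Two points with a common prefix of length \<open>n\<close> still share \<open>N\<close>
  symbols after \<open>i\<close> shifts unless \<open>i\<close> is among the last \<open>N\<close>
  indices. Uniform continuity handles the early indices and boundedness the few late ones, so the
  error is \<open>o(n)\<close>.\<close>

lemma birkhoff_sum_distortion:
  assumes X: "subshift k X" and f: "continuous_on X f"
  obtains v :: "nat \<Rightarrow> real" where "(\<lambda>n. v n / real n) \<longlonglongrightarrow> 0"
    "\<And>n. 0 \<le> v n"
    "\<And>n x x'. x \<in> X \<Longrightarrow> x' \<in> X \<Longrightarrow> prefix_word n x = prefix_word n x' \<Longrightarrow>
       \<bar>birkhoff_sum f n x - birkhoff_sum f n x'\<bar> \<le> v n"
proof -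
  obtain M where M: "0 \<le> M" "\<forall>x\<in>X. \<bar>f x\<bar> \<le> M" using subshift_bounded[OF X f] .
  \<comment> \<open>Inserting 0 keeps the set nonempty for every \<open>X\<close>, so that its
    supremum is meaningful and nonnegative.\<close>
  define D where "D n = insert 0 {\<bar>birkhoff_sum f n x - birkhoff_sum f n x'\<bar> | x x'.
    x \<in> X \<and> x' \<in> X \<and> prefix_word n x = prefix_word n x'}" for n
  define v where "v n = Sup (D n)" for n
  have bdd: "bdd_above (D n)" for n
  proof (rule bdd_aboveI[of _ "2 * (real n * M)"])
    fix d assume "d \<in> D n"
    then consider "d = 0"
      | x x' where "d = \<bar>birkhoff_sum f n x - birkhoff_sum f n x'\<bar>" "x \<in> X" "x' \<in> X"
      unfolding D_def by blast
    then show "d \<le> 2 * (real n * M)"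
    proof cases
      case 1
      then show ?thesis using M(1) by simp
    next
      case 2
      then show ?thesis
        using birkhoff_sum_abs_le[OF X M(2), of x n] birkhoff_sum_abs_le[OF X M(2), of x' n] by linarith
    qed
  qed
  have nonneg: "0 \<le> v n" for n unfolding v_def by (rule cSup_upper[OF _ bdd]) (simp add: D_def)
  have dist: "\<bar>birkhoff_sum f n x - birkhoff_sum f n x'\<bar> \<le> v n"
    if "x \<in> X" "x' \<in> X" "prefix_word n x = prefix_word n x'" for n x x'
    unfolding v_def by (rule cSup_upper[OF _ bdd]) (use that in \<open>auto simp: D_def\<close>)
  have "(\<lambda>n. v n / real n) \<longlonglongrightarrow> 0"
  proof (rule LIMSEQ_I)
    fix r :: real assume r: "0 < r"
    obtain N where N: "\<forall>x\<in>X. \<forall>x'\<in>X. prefix_word N x = prefix_word N x' \<longrightarrow> \<bar>f x - f x'\<bar> < r / 2"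
      using uniformly_continuous_prefix[OF X f, of "r/2"] r by auto
    have le: "v n \<le> real n * (r / 2) + real N * (2 * M)" for n
    proof -
      have "\<bar>birkhoff_sum f n x - birkhoff_sum f n x'\<bar> \<le> real n * (r / 2) + real N * (2 * M)"
        if x: "x \<in> X" "x' \<in> X" and eq: "prefix_word n x = prefix_word n x'" for x x'
      proof -
        have "\<bar>birkhoff_sum f n x - birkhoff_sum f n x'\<bar>
            \<le> (\<Sum>i<n. \<bar>f ((left_shift ^^ i) x) - f ((left_shift ^^ i) x')\<bar>)"
          unfolding birkhoff_sum_def sum_subtractf[symmetric] by (rule sum_abs)
        \<comment> \<open>The test \<open>n < i + N\<close> says that fewer than \<open>N\<close>
          common symbols remain; only then is the crude bound \<open>2 * M\<close> charged.\<close>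
        also have "\<dots> \<le> (\<Sum>i<n. r / 2 + (if n < i + N then 2 * M else 0))"
        proof (rule sum_mono)
          fix i assume "i \<in> {..<n}"
          note X' = subshift_funpow[OF X x(1), of i] subshift_funpow[OF X x(2), of i]
          show "\<bar>f ((left_shift ^^ i) x) - f ((left_shift ^^ i) x')\<bar>
              \<le> r / 2 + (if n < i + N then 2 * M else 0)"
          proof (cases "n < i + N")
            case True
            have "\<bar>f ((left_shift ^^ i) x)\<bar> \<le> M" "\<bar>f ((left_shift ^^ i) x')\<bar> \<le> M" using M X' by auto
            then show ?thesis using True r by auto
          next
            case False
            then have "prefix_word N ((left_shift ^^ i) x) = prefix_word N ((left_shift ^^ i) x')"
              using eq by (auto simp: prefix_word_eq_iff funpow_left_shift)
            then show ?thesis using N X' False by (auto simp: less_imp_le)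
          qed
        qed
        also have "\<dots> = real n * (r / 2) + (\<Sum>i\<in>{..<n} \<inter> {i. n < i + N}. 2 * M)"
          by (simp only: sum.distrib sum.inter_restrict[OF finite_lessThan] mem_Collect_eq) simp
        also have "(\<Sum>i\<in>{..<n} \<inter> {i. n < i + N}. 2 * M) \<le> real N * (2 * M)"
        proof -
          have "{..<n} \<inter> {i. n < i + N} \<subseteq> {n - N..<n}" by auto
          then have "card ({..<n} \<inter> {i. n < i + N}) \<le> card {n - N..<n}" by (intro card_mono) auto
          then have "card ({..<n} \<inter> {i. n < i + N}) \<le> N" by simp
          then show ?thesis using M(1) by (simp add: mult_right_mono)
        qed
        finally show ?thesis by simp
      qed
      then show ?thesis unfolding v_def using r M(1)
        by (intro cSup_least) (auto simp: D_def)
    qed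
    have "(\<lambda>n. r / 2 + real N * (2 * M) / real n) \<longlonglongrightarrow> r / 2 + 0"
      by (intro tendsto_add tendsto_const lim_const_over_n)
    then have "\<forall>\<^sub>F n in sequentially. r / 2 + real N * (2 * M) / real n < r"
      by (rule order_tendstoD(2)) (use r in simp)
    then have "\<forall>\<^sub>F n in sequentially. v n / real n < r"
      using eventually_gt_at_top[of 0]
    proof eventually_elim
      case (elim n)
      have "v n / real n \<le> (real n * (r / 2) + real N * (2 * M)) / real n"
        by (rule divide_right_mono[OF le]) simp
      also have "\<dots> = r / 2 + real N * (2 * M) / real n" using elim by (simp add: field_simps)
      finally show ?case using elim by simp
    qed
    then show "\<exists>no. \<forall>n\<ge>no. norm (v n / real n - 0) < r"
      using nonneg by (auto simp: eventually_sequentially)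
  qed
  then show ?thesis using that nonneg dist by blast
qed

section \<open>Almost multiplicativity from approximation by Birkhoff sums\<close>

text \<open>Birkhoff sums are additive along the orbit, so they cancel in the logarithm of the
  quotient and only the three approximation errors remain.\<close>

lemma almost_multiplicative_if_birkhoff_approx:
  fixes e :: "nat \<Rightarrow> real"
  assumes pos: "\<And>n y. 1 \<le> n \<Longrightarrow> y \<in> Y \<Longrightarrow> 0 < g n y"
    and shift: "\<And>n y. y \<in> Y \<Longrightarrow> (left_shift ^^ n) y \<in> Y"
    and approx: "\<And>n y. 1 \<le> n \<Longrightarrow> y \<in> Y \<Longrightarrow> \<bar>ln (g n y) - birkhoff_sum h n y\<bar> \<le> e n"
    and e: "(\<lambda>n. e n / real n) \<longlonglongrightarrow> 0"
  shows "\<exists>C. almost_multiplicative Y g C"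
proof -
  define C where "C n m = exp (e n + e m + e (n + m))" for n m
  have bounds: "1 / C n m \<le> g (n + m) y / (g n y * g m ((left_shift ^^ n) y)) \<and>
      g (n + m) y / (g n y * g m ((left_shift ^^ n) y)) \<le> C n m"
    if y: "y \<in> Y" and nm: "1 \<le> n" "1 \<le> m" for y n m
  proof -
    define q where "q = g (n + m) y / (g n y * g m ((left_shift ^^ n) y))"
    have p: "0 < g n y" "0 < g m ((left_shift ^^ n) y)" "0 < g (n + m) y"
      using pos nm y shift by auto
    then have q: "0 < q" by (simp add: q_def)
    have "ln q = ln (g (n + m) y) - ln (g n y) - ln (g m ((left_shift ^^ n) y))"
      using p by (simp add: q_def ln_div ln_mult)
    then have "\<bar>ln q\<bar> \<le> e n + e m + e (n + m)"
      using approx[OF nm(1) y] approx[OF nm(2) shift[OF y, of n]] approx[of "n + m" y] nm y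
        birkhoff_sum_add[of h n m y] by simp
    then have "- (e n + e m + e (n + m)) \<le> ln q" "ln q \<le> e n + e m + e (n + m)" by linarith+
    then have "exp (- (e n + e m + e (n + m))) \<le> exp (ln q)" "exp (ln q) \<le> C n m"
      unfolding C_def exp_le_cancel_iff .
    then show ?thesis unfolding q_def[symmetric] using q
      by (simp only: C_def exp_minus inverse_eq_divide exp_ln)
  qed
  have lim: "(\<lambda>n. 1 / real n * (e n + e m + e (n + m))) \<longlonglongrightarrow> 0" for m
  proof -
    have "(\<lambda>n. e (n + m) / real (n + m)) \<longlonglongrightarrow> 0" using LIMSEQ_ignore_initial_segment[OF e, of m] .
    moreover have "(\<lambda>n. 1 + real m / real n) \<longlonglongrightarrow> 1 + 0"
      by (intro tendsto_add tendsto_const lim_const_over_n)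
    ultimately have "(\<lambda>n. e (n + m) / real (n + m) * (1 + real m / real n)) \<longlonglongrightarrow> 0 * (1 + 0)"
      by (rule tendsto_mult)
    \<comment> \<open>The error \<open>e (n + m)\<close> is small relative to \<open>n + m\<close>
      but is divided by \<open>n\<close>; the factor \<open>1 + m / n\<close> converts between the
      two.\<close>
    then have "(\<lambda>n. e n / real n + e m / real n + e (n + m) / real (n + m) * (1 + real m / real n))
        \<longlonglongrightarrow> 0 + 0 + 0 * (1 + 0)"
      by (intro tendsto_add e lim_const_over_n)
    moreover have "\<forall>\<^sub>F n in sequentially. e n / real n + e m / real n
        + e (n + m) / real (n + m) * (1 + real m / real n) = 1 / real n * (e n + e m + e (n + m))"
      using eventually_gt_at_top[of 0]
    proof eventually_elim
      case (elim n)
      then have "1 + real m / real n = real (n + m) / real n" by (simp add: field_simps)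
      then have "e (n + m) / real (n + m) * (1 + real m / real n) = e (n + m) / real n"
        using elim by (simp del: of_nat_add)
      then show ?case by (simp add: add_divide_distrib)
    qed
    ultimately show ?thesis by (auto intro: Lim_transform_eventually)
  qed
  have "almost_multiplicative Y g C"
    unfolding almost_multiplicative_def
  proof (intro conjI ballI allI impI)
    fix n
    \<comment> \<open>\<open>C\<close> is symmetric in its two indices, so the same limit settles
      both conditions.\<close>
    show "(\<lambda>m. 1 / real m * ln (C n m)) \<longlonglongrightarrow> 0" using lim[of n] by (simp add: C_def ac_simps)
  next
    fix m
    show "(\<lambda>n. 1 / real n * ln (C n m)) \<longlonglongrightarrow> 0" using lim[of m] by (simp add: C_def)
  qed (use bounds in \<open>auto simp: C_def\<close>)
  then show ?thesis by blast
qed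

section \<open>Fibre sums of a one-block factor\<close>

locale one_block_factor =
  fixes k l :: nat
    and X Y :: "(nat \<Rightarrow> nat) set"
    and \<pi> :: "(nat \<Rightarrow> nat) \<Rightarrow> nat \<Rightarrow> nat"
    and \<Phi> :: "nat \<Rightarrow> nat"
    and f :: "(nat \<Rightarrow> nat) \<Rightarrow> real"
  assumes X: "subshift k X"
    and Y: "subshift l Y"
    and factor: "factor_map X Y \<pi>"
    and block: "one_block_map X \<Phi> \<pi>"
    and cont: "continuous_on X f"
    and nonempty: "X \<noteq> {}"
begin

abbreviation "g \<equiv> fibre_sum X \<Phi> f"

lemma k_pos: "1 \<le> k"
  using X by (simp add: subshift_def)

lemma shift_X: "x \<in> X \<Longrightarrow> (left_shift ^^ n) x \<in> X"
  using X by (rule subshift_funpow)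

lemma shift_Y: "y \<in> Y \<Longrightarrow> (left_shift ^^ n) y \<in> Y"
  using Y by (rule subshift_funpow)

lemma factor_Y: "x \<in> X \<Longrightarrow> \<pi> x \<in> Y"
  using factor by (auto simp: factor_map_def)

lemma factor_symbol: "x \<in> X \<Longrightarrow> \<pi> x i = \<Phi> (x i)"
  using block by (auto simp: one_block_map_def)

lemma map_prefix_word: "x \<in> X \<Longrightarrow> map \<Phi> (prefix_word n x) = prefix_word n (\<pi> x)"
  by (rule nth_equalityI) (auto simp: factor_symbol)

lemma fibre_words_eq:
  "fibre_words X \<Phi> n y = prefix_word n ` {x \<in> X. prefix_word n (\<pi> x) = prefix_word n y}"
  using map_prefix_word unfolding fibre_words_def words_of_length_eq_prefixes[OF X nonempty]
  by force

lemma prefix_mem_fibre_words: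
  "x \<in> X \<Longrightarrow> prefix_word n x \<in> fibre_words X \<Phi> n y \<longleftrightarrow> prefix_word n (\<pi> x) = prefix_word n y"
  by (auto simp: fibre_words_def map_prefix_word words_of_length_eq_prefixes[OF X nonempty])

lemma length_fibre_word: "u \<in> fibre_words X \<Phi> n y \<Longrightarrow> length u = n"
  by (auto simp: fibre_words_eq)

lemma finite_fibre_words: "finite (fibre_words X \<Phi> n y)"
  unfolding fibre_words_def using finite_words_of_length(1)[OF X] by simp

lemma card_fibre_words: "card (fibre_words X \<Phi> n y) \<le> k ^ n"
proof -
  have "card (fibre_words X \<Phi> n y) \<le> card (words_of_length X n)"
    by (rule card_mono[OF finite_words_of_length(1)[OF X]]) (auto simp: fibre_words_def)
  also note finite_words_of_length(2)[OF X]
  finally show ?thesis .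
qed

lemma fibre_words_nonempty: "y \<in> Y \<Longrightarrow> fibre_words X \<Phi> n y \<noteq> {}"
  using factor unfolding fibre_words_eq factor_map_def by auto

text \<open>Taking a point that maximises the Birkhoff sum on each cylinder makes \<open>g\<close> submultiplicative
  with constant 1, so no error accumulates over many periods of a periodic point.\<close>

definition peak :: "nat list \<Rightarrow> nat \<Rightarrow> nat" where
  "peak u = (SOME x. x \<in> cylinder X u \<and>
     (\<forall>z\<in>cylinder X u. birkhoff_sum f (length u) z \<le> birkhoff_sum f (length u) x))"

text \<open>The choice in \<open>peak\<close> is justified by compactness of the cylinder and
  continuity of the Birkhoff sum, which attains its maximum there.\<close>

lemma peak:
  assumes "x \<in> X"
  shows "peak (prefix_word n x) \<in> X"
    and "prefix_word n (peak (prefix_word n x)) = prefix_word n x"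
    and "birkhoff_sum f n x \<le> birkhoff_sum f n (peak (prefix_word n x))"
proof -
  let ?C = "cylinder X (prefix_word n x)"
  have C: "?C = X \<inter> {z. prefix_word n z = prefix_word n x}" by (auto simp: cylinder_def)
  have "compact ?C"
    unfolding C by (rule compact_Int_closed[OF subshift_compact[OF X] closed_prefix])
  moreover have "?C \<noteq> {}" unfolding C using assms by auto
  moreover have "continuous_on ?C (birkhoff_sum f n)"
    using continuous_on_birkhoff_sum[OF X cont] by (rule continuous_on_subset) (auto simp: C)
  ultimately obtain z where "z \<in> ?C" "\<forall>z'\<in>?C. birkhoff_sum f n z' \<le> birkhoff_sum f n z"
    by (rule continuous_attains_sup[THEN bexE]) blast
  then have "\<exists>z. z \<in> ?C \<and> (\<forall>z'\<in>?C. birkhoff_sum f (length (prefix_word n x)) z'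
      \<le> birkhoff_sum f (length (prefix_word n x)) z)" by auto
  from someI_ex[OF this, folded peak_def] have *: "peak (prefix_word n x) \<in> ?C"
    "\<forall>z'\<in>?C. birkhoff_sum f n z' \<le> birkhoff_sum f n (peak (prefix_word n x))" by auto
  show "peak (prefix_word n x) \<in> X" "prefix_word n (peak (prefix_word n x)) = prefix_word n x"
    using *(1) by (auto simp: C)
  show "birkhoff_sum f n x \<le> birkhoff_sum f n (peak (prefix_word n x))"
    using *(2) assms by (auto simp: C)
qed

lemma peak_fibre_word:
  assumes "u \<in> fibre_words X \<Phi> n y"
  shows "peak u \<in> X" "prefix_word n (peak u) = u" "prefix_word n (\<pi> (peak u)) = prefix_word n y"
proof -
  obtain x where x: "x \<in> X" "u = prefix_word n x" using assms by (auto simp: fibre_words_eq)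
  show "peak u \<in> X" "prefix_word n (peak u) = u" using peak(1,2)[OF x(1)] x(2) by auto
  then show "prefix_word n (\<pi> (peak u)) = prefix_word n y"
    using map_prefix_word[of "peak u" n] assms by (simp add: fibre_words_def)
qed

text \<open>For a word \<open>u\<close> of \<open>X\<close> this is the supremum of
  \<open>exp\<close> of the Birkhoff sum over the cylinder of \<open>u\<close>, the summand
  occurring in the pressure.\<close>

definition weight :: "nat list \<Rightarrow> real" where
  "weight u = exp (birkhoff_sum f (length u) (peak u))"

lemma weight_pos: "0 < weight u"
  by (simp add: weight_def)

text \<open>Points with distinct prefixes sit in distinct cylinders, and each term is at most the
  maximum on its cylinder. This bounds an arbitrary selection from above and, read the other way,
  bounds \<open>g\<close> from below by any family of preimages with distinct prefixes.\<close>

lemma sum_injection_le_weight: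
  assumes S: "finite S" "inj_on (\<lambda>s. prefix_word n (\<xi> s)) S"
    and \<xi>: "\<And>s. s \<in> S \<Longrightarrow> \<xi> s \<in> X" "\<And>s. s \<in> S \<Longrightarrow> prefix_word n (\<pi> (\<xi> s)) = prefix_word n y"
  shows "(\<Sum>s\<in>S. exp (birkhoff_sum f n (\<xi> s))) \<le> (\<Sum>u\<in>fibre_words X \<Phi> n y. weight u)"
proof -
  have "(\<Sum>s\<in>S. exp (birkhoff_sum f n (\<xi> s))) \<le> (\<Sum>s\<in>S. weight (prefix_word n (\<xi> s)))"
    by (intro sum_mono) (use peak(3) \<xi>(1) in \<open>auto simp: weight_def\<close>)
  also have "\<dots> = (\<Sum>u\<in>(\<lambda>s. prefix_word n (\<xi> s)) ` S. weight u)"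
    by (simp add: sum.reindex[OF S(2)])
  also have "\<dots> \<le> (\<Sum>u\<in>fibre_words X \<Phi> n y. weight u)"
    by (rule sum_mono2[OF finite_fibre_words])
      (use \<xi> less_imp_le[OF weight_pos] in \<open>auto simp: fibre_words_eq\<close>)
  finally show ?thesis .
qed

text \<open>The supremum over selections is attained by selecting the peaks, because the cylinders
  can be optimised independently. All later estimates use this finite sum.\<close>

lemma fibre_sum_eq: "g n y = (\<Sum>u\<in>fibre_words X \<Phi> n y. weight u)"
  unfolding fibre_sum_def
proof (rule cSup_eq_maximum)
  let ?U = "fibre_words X \<Phi> n y"
  have inj: "inj_on peak ?U" by (rule inj_on_inverseI[of _ "prefix_word n"]) (rule peak_fibre_word(2))
  have "peak ` ?U \<in> fibre_selections X \<Phi> n y"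
    unfolding fibre_selections_def
  proof (intro CollectI conjI ballI)
    show "peak ` ?U \<subseteq> (\<Union>u\<in>?U. cylinder X u)"
      using peak_fibre_word length_fibre_word by (fastforce simp: cylinder_def)
    fix u assume u: "u \<in> ?U"
    show "\<exists>!x. x \<in> peak ` ?U \<inter> cylinder X u"
    proof (rule ex1I)
      show "peak u \<in> peak ` ?U \<inter> cylinder X u"
        using peak_fibre_word[OF u] u by (auto simp: cylinder_def length_fibre_word[OF u])
      fix x assume "x \<in> peak ` ?U \<inter> cylinder X u"
      then show "x = peak u"
        using peak_fibre_word(2) by (auto simp: cylinder_def length_fibre_word[OF u])
    qed
  qed
  moreover have "(\<Sum>x\<in>peak ` ?U. exp (birkhoff_sum f n x)) = (\<Sum>u\<in>?U. weight u)"
    by (simp add: sum.reindex[OF inj] weight_def length_fibre_word)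
  ultimately show "(\<Sum>u\<in>?U. weight u) \<in>
      (\<lambda>E. \<Sum>x\<in>E. exp (birkhoff_sum f n x)) ` fibre_selections X \<Phi> n y"
    by (intro image_eqI[where x = "peak ` ?U"]) simp_all
next
  let ?U = "fibre_words X \<Phi> n y"
  fix r assume "r \<in> (\<lambda>E. \<Sum>x\<in>E. exp (birkhoff_sum f n x)) ` fibre_selections X \<Phi> n y"
  then obtain E where E: "E \<subseteq> (\<Union>u\<in>?U. cylinder X u)" "\<forall>u\<in>?U. \<exists>!x. x \<in> E \<inter> cylinder X u"
    and r: "r = (\<Sum>x\<in>E. exp (birkhoff_sum f n x))"
    by (auto simp: fibre_selections_def)
  have mem: "x \<in> X" "prefix_word n x \<in> ?U" if "x \<in> E" for x
    using E(1) that length_fibre_word by (fastforce simp: cylinder_def)+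
  have inj: "inj_on (prefix_word n) E"
  proof (rule inj_onI)
    fix x x' assume *: "x \<in> E" "x' \<in> E" "prefix_word n x = prefix_word n x'"
    then have "x \<in> E \<inter> cylinder X (prefix_word n x)" "x' \<in> E \<inter> cylinder X (prefix_word n x)"
      using mem(1) by (auto simp: cylinder_def)
    then show "x = x'" using E(2) mem(2)[OF *(1)] by blast
  qed
  have "finite E"
    by (rule finite_imageD[OF finite_subset[OF _ finite_fibre_words[of n y]] inj]) (use mem in auto)
  then show "r \<le> (\<Sum>u\<in>?U. weight u)"
    unfolding r using inj
  proof (rule sum_injection_le_weight)
    fix x assume "x \<in> E"
    then show "x \<in> X" "prefix_word n (\<pi> x) = prefix_word n y"
      using mem map_prefix_word by (auto simp: fibre_words_def)
  qed
qed

lemma fibre_sum_pos: "y \<in> Y \<Longrightarrow> 0 < g n y"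
  unfolding fibre_sum_eq
  by (intro sum_pos finite_fibre_words fibre_words_nonempty weight_pos)

text \<open>Cutting a fibre word after \<open>n\<close> symbols gives fibre words of
  \<open>y\<close> and of its shift. The Birkhoff sum at the peak of the whole word splits
  accordingly, and each part is at most the value at the peak of its half.\<close>

lemma fibre_sum_submult: "g (n + m) y \<le> g n y * g m ((left_shift ^^ n) y)"
proof -
  let ?U = "fibre_words X \<Phi> (n + m) y" and ?V = "fibre_words X \<Phi> n y"
    and ?W = "fibre_words X \<Phi> m ((left_shift ^^ n) y)"
  have split: "take n u \<in> ?V \<and> drop n u \<in> ?W \<and> weight u \<le> weight (take n u) * weight (drop n u)"
    if u: "u \<in> ?U" for u
  proof -
    define x where "x = peak u"
    have x: "x \<in> X" "prefix_word (n + m) x = u" "prefix_word (n + m) (\<pi> x) = prefix_word (n + m) y"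
      using peak_fibre_word[OF u] by (simp_all add: x_def)
    let ?x' = "(left_shift ^^ n) x"
    have x': "?x' \<in> X" using shift_X[OF x(1)] .
    have u_eq: "u = prefix_word n x @ prefix_word m ?x'" using x(2) by (simp add: prefix_word_add)
    have "take n u \<in> ?V" using x unfolding u_eq fibre_words_eq
      by (auto simp: prefix_word_eq_iff)
    moreover have "prefix_word m (\<pi> ?x') = prefix_word m ((left_shift ^^ n) y)"
      using x(3) x(1) x' by (auto simp: prefix_word_eq_iff factor_symbol funpow_left_shift)
    then have "drop n u \<in> ?W" using x' unfolding u_eq fibre_words_eq by auto
    moreover have "birkhoff_sum f (n + m) x
        \<le> birkhoff_sum f n (peak (prefix_word n x)) + birkhoff_sum f m (peak (prefix_word m ?x'))"
      unfolding birkhoff_sum_add by (intro add_mono peak(3) x(1) x')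
    then have "weight u \<le> weight (take n u) * weight (drop n u)"
      unfolding weight_def length_fibre_word[OF u] x_def[symmetric]
      by (simp add: u_eq exp_add[symmetric])
    ultimately show ?thesis by blast
  qed
  \<comment> \<open>A word is recovered from its two halves, so the cut words form a subset of the
    product and positivity allows passing to the whole product.\<close>
  have inj: "inj_on (\<lambda>u. (take n u, drop n u)) ?U"
    by (rule inj_on_inverseI[of _ "\<lambda>(v, w). v @ w"]) simp
  have "g (n + m) y \<le> (\<Sum>u\<in>?U. weight (take n u) * weight (drop n u))"
    unfolding fibre_sum_eq by (intro sum_mono) (use split in blast)
  also have "\<dots> = (\<Sum>(v, w)\<in>(\<lambda>u. (take n u, drop n u)) ` ?U. weight v * weight w)"
    by (simp add: sum.reindex[OF inj])
  also have "\<dots> \<le> (\<Sum>(v, w)\<in>?V \<times> ?W. weight v * weight w)"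
    by (rule sum_mono2) (use split weight_pos finite_fibre_words in \<open>auto intro: less_imp_le\<close>)
  also have "\<dots> = g n y * g m ((left_shift ^^ n) y)"
    unfolding fibre_sum_eq sum_product sum.cartesian_product ..
  finally show ?thesis .
qed

lemma fibre_sum_le_power:
  assumes "\<forall>x\<in>X. \<bar>f x\<bar> \<le> M"
  shows "g n y \<le> (real k * exp M) ^ n"
proof -
  have "weight u \<le> exp (real n * M)" if u: "u \<in> fibre_words X \<Phi> n y" for u
    using birkhoff_sum_abs_le[OF X assms peak_fibre_word(1)[OF u], of n]
    by (simp add: weight_def length_fibre_word[OF u])
  then have "g n y \<le> real (card (fibre_words X \<Phi> n y)) * exp (real n * M)"
    unfolding fibre_sum_eq by (rule sum_bounded_above)
  also have "\<dots> \<le> real (k ^ n) * exp (real n * M)"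
    by (intro mult_right_mono of_nat_mono card_fibre_words) simp
  finally show ?thesis by (simp add: power_mult_distrib exp_of_nat_mult)
qed

text \<open>\<open>g n\<close> depends on \<open>y\<close> only through its prefix of length
  \<open>n\<close>, a measurable map into a countable discrete space.\<close>

lemma fibre_sum_measurable: "(\<lambda>y. ln (g n y)) \<in> borel_measurable (restrict_space borel Y)"
proof -
  have "prefix_word n \<in> measurable borel (count_space UNIV)"
  proof (subst measurable_count_space_eq2_countable, intro conjI ballI)
    fix u :: "nat list"
    have "prefix_word n -` {u} = {z. prefix_word n z = u}" by auto
    then show "prefix_word n -` {u} \<inter> space borel \<in> sets borel" using borel_prefix by simp
  qed simp
  then have "(\<lambda>y. (\<lambda>v. ln (\<Sum>u\<in>{u \<in> words_of_length X n. map \<Phi> u = v}. weight u)) (prefix_word n y))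
      \<in> borel_measurable borel"
    by (rule measurable_compose) simp
  then have "(\<lambda>y. ln (g n y)) \<in> borel_measurable borel"
    by (simp add: fibre_sum_eq fibre_words_def)
  then show ?thesis by (rule measurable_restrict_space1)
qed

end

section \<open>Closing words up to periodic points of the factor\<close>

lemma birkhoff_sum_blocks:
  "birkhoff_sum f (N * L) x = (\<Sum>j<N. birkhoff_sum f L ((left_shift ^^ (j * L)) x))"
proof (induction N)
  case (Suc N)
  have "birkhoff_sum f (Suc N * L) x = birkhoff_sum f (N * L + L) x" by (simp add: add.commute)
  then show ?case using Suc by (simp add: birkhoff_sum_add)
qed (simp add: birkhoff_sum_def)

lemma one_step_sft_transition:
  assumes "one_step_sft k X"
  obtains R where "X = {x \<in> full_shift k. \<forall>i. R (x i) (x (Suc i))}"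
proof -
  obtain F where F: "\<forall>w\<in>F. length w \<le> 2" "X = {x \<in> full_shift k. \<forall>i n. subword x i n \<notin> F}"
    using assms unfolding one_step_sft_def by blast
  \<comment> \<open>Every position starts a pair, so the empty and one-letter forbidden blocks can
    be tested at the first symbol of the pair.\<close>
  define R where "R a b \<longleftrightarrow> [] \<notin> F \<and> [a] \<notin> F \<and> [a, b] \<notin> F" for a b
  have "(\<forall>n. subword x i n \<notin> F) \<longleftrightarrow> R (x i) (x (Suc i))" for x i
  proof
    assume *: "\<forall>n. subword x i n \<notin> F"
    show "R (x i) (x (Suc i))"
      using *[rule_format, of 0] *[rule_format, of 1] *[rule_format, of 2]
      by (simp add: R_def subword_def numeral_2_eq_2 upt_rec)
  next
    assume *: "R (x i) (x (Suc i))"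
    show "\<forall>n. subword x i n \<notin> F"
    proof
      fix n :: nat
      consider "n = 0" | "n = 1" | "n = 2" | "n > 2" by linarith
      then show "subword x i n \<notin> F"
      proof cases
        case 4
        then show ?thesis using F(1) by (force simp: subword_def)
      qed (use * in \<open>auto simp: R_def subword_def numeral_2_eq_2 upt_rec\<close>)
    qed
  qed
  then have "X = {x \<in> full_shift k. \<forall>i. R (x i) (x (Suc i))}" using F(2) by auto
  then show ?thesis using that by blast
qed

text \<open>Irreducibility joins the two one-letter words, and the joined word is a prefix of a
  point \<open>c\<close>. Here \<open>q\<close> counts the symbols strictly between the two
  ends.\<close>

lemma irreducible_connectors:
  assumes X: "subshift k X" and irr: "irreducible_shift X"
    and x: "x \<in> X" and x': "x' \<in> X"
  obtains c q where "c \<in> X" "c 0 = x i" "c (Suc q) = x' j"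
proof -
  have single: "[z i] \<in> language X" if "z \<in> X" for z i
  proof -
    have "subword z i 1 \<in> words_of_length X 1" using that by (auto simp: words_of_length_def)
    moreover have "subword z i 1 = [z i]" by (simp add: subword_def)
    ultimately show ?thesis unfolding language_def by auto
  qed
  obtain w where "[x i] @ w @ [x' j] \<in> language X"
    using irr single[OF x] single[OF x'] unfolding irreducible_shift_def by blast
  then obtain n where n: "[x i] @ w @ [x' j] \<in> words_of_length X n" by (auto simp: language_def)
  have "X \<noteq> {}" using x by auto
  then obtain c where c: "c \<in> X" "[x i] @ w @ [x' j] = prefix_word n c"
    using n words_of_length_eq_prefixes[OF X, of n] by auto
  have len: "n = Suc (Suc (length w))" using arg_cong[OF c(2), of length] by simp
  have "c 0 = x i" using arg_cong[OF c(2), of "\<lambda>u. u ! 0"] len by simp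
  moreover have "c (Suc (length w)) = x' j"
    using arg_cong[OF c(2), of "\<lambda>u. u ! Suc (length w)"] len by (simp add: nth_append)
  ultimately show ?thesis using c(1) that by blast
qed

context one_block_factor
begin

text \<open>The gap bound \<open>p\<close> is chosen before \<open>n\<close> and \<open>y\<close>.
  The lower bound is an exact \<open>N\<close>-th power with a base independent of \<open>N\<close>,
  so the loss per period does not grow when the number of periods tends to infinity.\<close>

lemma closing:
  assumes sft: "one_step_sft k X" and irr: "irreducible_shift X"
    and M: "0 \<le> M" "\<forall>x\<in>X. \<bar>f x\<bar> \<le> M"
    and v: "\<And>n x x'. x \<in> X \<Longrightarrow> x' \<in> X \<Longrightarrow> prefix_word n x = prefix_word n x' \<Longrightarrow>
       \<bar>birkhoff_sum f n x - birkhoff_sum f n x'\<bar> \<le> v n"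
  obtains p where "\<And>n y. 1 \<le> n \<Longrightarrow> y \<in> Y \<Longrightarrow> \<exists>z q. z \<in> Y \<and> q \<le> p \<and>
    prefix_word n z = prefix_word n y \<and> (left_shift ^^ (n + q)) z = z \<and>
    (\<forall>N. (exp (- (v n + real p * M)) * (g n y / real k ^ 2)) ^ N \<le> g (N * (n + q)) z)"
proof -
  define A where "A = {x i | x i. x \<in> X}"
  have A: "finite A"
    by (rule finite_subset[of _ "{1..k}"]) (use subshift_symbol[OF X] in \<open>auto simp: A_def\<close>)
  have "\<exists>c q. c \<in> X \<and> c 0 = b \<and> c (Suc q) = a" if "a \<in> A" "b \<in> A" for a b
    using that irreducible_connectors[OF X irr] unfolding A_def by blast
  then obtain c q where c: "\<And>a b. a \<in> A \<Longrightarrow> b \<in> A \<Longrightarrow>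
      c a b \<in> X \<and> c a b 0 = b \<and> c a b (Suc (q a b)) = a" by metis
  \<comment> \<open>One connector is fixed for each of the finitely many pairs of symbols; the sum
    dominates all their gap lengths.\<close>
  define p where "p = (\<Sum>(a, b)\<in>A \<times> A. q a b)"
  have p: "q a b \<le> p" if "a \<in> A" "b \<in> A" for a b
    using member_le_sum[of "(a, b)" "A \<times> A" "\<lambda>(a, b). q a b"] that A by (simp add: p_def)
  obtain R where R: "X = {x \<in> full_shift k. \<forall>i. R (x i) (x (Suc i))}"
    using one_step_sft_transition[OF sft] .
  have "\<exists>z q. z \<in> Y \<and> q \<le> p \<and>
      prefix_word n z = prefix_word n y \<and> (left_shift ^^ (n + q)) z = z \<and>
      (\<forall>N. (exp (- (v n + real p * M)) * (g n y / real k ^ 2)) ^ N \<le> g (N * (n + q)) z)"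
    if n: "1 \<le> n" and y: "y \<in> Y" for n y
  proof -
    txt \<open>Restricting to preimage words with a common first and a common last symbol costs at most the
      factor \<open>k\<^sup>2\<close> and lets a single connector join any two of them, so that all concatenations have
      the same periodic image \<open>z\<close>.\<close>
    let ?U = "fibre_words X \<Phi> n y"
    define B where "B a b = {u \<in> ?U. u ! 0 = a \<and> u ! (n - 1) = b}" for a b
    have "\<exists>a\<in>{1..k}. \<exists>b\<in>{1..k}. g n y / real k ^ 2 \<le> (\<Sum>u\<in>B a b. weight u)"
    proof (rule ccontr)
      assume "\<not> ?thesis"
      then have less: "(\<Sum>u\<in>B a b. weight u) < g n y / real k ^ 2" if "a \<in> {1..k}" "b \<in> {1..k}" for a b
        using that by force
      have sub: "(\<lambda>u. (u ! 0, u ! (n - 1))) ` ?U \<subseteq> {1..k} \<times> {1..k}"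
      proof (rule image_subsetI)
        fix u assume "u \<in> ?U"
        then obtain x where "x \<in> X" "u = prefix_word n x" by (auto simp: fibre_words_eq)
        then show "(u ! 0, u ! (n - 1)) \<in> {1..k} \<times> {1..k}"
          using n subshift_symbol[OF X, of x] by simp
      qed
      \<comment> \<open>Pigeonhole: if each of the \<open>k^2\<close> classes weighed less than the
        average, their total would be less than \<open>g n y\<close>.\<close>
      have "g n y = (\<Sum>ab\<in>{1..k} \<times> {1..k}. \<Sum>u\<in>{u \<in> ?U. (u ! 0, u ! (n - 1)) = ab}. weight u)"
        unfolding fibre_sum_eq by (rule sum.group[OF finite_fibre_words _ sub, symmetric]) simp
      also have "\<dots> = (\<Sum>(a, b)\<in>{1..k} \<times> {1..k}. \<Sum>u\<in>B a b. weight u)"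
        by (rule sum.cong) (auto simp: B_def)
      also have "\<dots> < (\<Sum>(a, b)\<in>{1..k} \<times> {1..k}. g n y / real k ^ 2)"
        by (rule sum_strict_mono) (use less k_pos in auto)
      also have "\<dots> = g n y" using k_pos by (simp add: power2_eq_square)
      finally show False by simp
    qed
    then obtain a b where ab: "g n y / real k ^ 2 \<le> (\<Sum>u\<in>B a b. weight u)" by blast
    have "0 < g n y / real k ^ 2" using fibre_sum_pos[OF y] k_pos by simp
    then have "B a b \<noteq> {}" using ab by (metis less_le_not_le order.strict_trans1 sum.empty)
    then obtain u0 where u0: "u0 \<in> B a b" by blast
    have B: "peak u \<in> X" "prefix_word n (peak u) = u" "prefix_word n (\<pi> (peak u)) = prefix_word n y"
      "peak u 0 = a" "peak u (n - 1) = b" "length u = n" if "u \<in> B a b" for u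
    proof -
      have u: "u \<in> ?U" "u ! 0 = a" "u ! (n - 1) = b" using that by (auto simp: B_def)
      show 1: "peak u \<in> X" "prefix_word n (peak u) = u"
        "prefix_word n (\<pi> (peak u)) = prefix_word n y" using peak_fibre_word[OF u(1)] .
      show "length u = n" using length_fibre_word[OF u(1)] .
      show "peak u 0 = a" "peak u (n - 1) = b"
        using u(2,3) n nth_prefix_word[of 0 n "peak u"] nth_prefix_word[of "n - 1" n "peak u"] 1(2)
        by auto
    qed
    have abA: "a \<in> A" "b \<in> A" using B(1,4,5)[OF u0] by (auto simp: A_def)
    define C where "C = c a b"
    define Q where "Q = q a b"
    have C: "C \<in> X" "C 0 = b" "C (Suc Q) = a" using c[OF abA] by (auto simp: C_def Q_def)
    have Q: "Q \<le> p" using p[OF abA] by (simp add: Q_def)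
    define L where "L = n + Q"
    have L: "0 < L" "n \<le> L" using n by (auto simp: L_def)
    \<comment> \<open>The connector starts at index 1, since \<open>C 0 = b\<close> is already the
      last symbol of the word, and it stops at index \<open>Q\<close>, since
      \<open>C (Suc Q) = a\<close> is the first symbol of the next block.\<close>
    define blk where "blk u i = (if i < n then peak u i else C (Suc i - n))" for u i
    define \<xi> where "\<xi> s i = blk (s (i div L)) (i mod L)" for s :: "nat \<Rightarrow> nat list" and i
    \<comment> \<open>Position \<open>L\<close> lies just past the block, where the formula yields
      the common first symbol of all blocks. A transition between blocks can thus be read as one
      inside a single block.\<close>
    have blk_end: "blk u L = a" for u using C(3) by (simp add: blk_def L_def Suc_diff_le)
    have blk_R: "R (blk u r) (blk u (Suc r))" if u: "u \<in> B a b" and r: "r < L" for u r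
    proof -
      have RX: "R (x i) (x (Suc i))" if "x \<in> X" for x i using that R by blast
      consider "Suc r < n" | "Suc r = n" | "n \<le> r" by linarith
      then show ?thesis
      proof cases
        case 1
        then show ?thesis using RX[OF B(1)[OF u], of r] by (simp add: blk_def)
      next
        case 2
        then have "peak u r = C 0" using B(5)[OF u] C(2) by auto
        then show ?thesis using RX[OF C(1), of 0] 2 by (simp add: blk_def)
      next
        case 3
        then show ?thesis using RX[OF C(1), of "Suc r - n"] by (simp add: blk_def Suc_diff_le)
      qed
    qed
    have \<xi>X: "\<xi> s \<in> X" if s: "\<And>j. s j \<in> B a b" for s
    proof -
      have "\<xi> s i \<in> {1..k}" for i
        using subshift_symbol[OF X] B(1)[OF s] C(1) by (simp add: \<xi>_def blk_def)
      moreover have "R (\<xi> s i) (\<xi> s (Suc i))" for i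
      proof -
        have r: "i mod L < L" using L by simp
        have "\<xi> s (Suc i) = blk (s (i div L)) (Suc (i mod L))"
        proof (cases "Suc (i mod L) = L")
          case True
          then have "Suc i mod L = 0" by (simp add: mod_Suc)
          then have "\<xi> s (Suc i) = a" using B(4)[OF s] n by (simp add: \<xi>_def blk_def)
          then show ?thesis using True blk_end by metis
        next
          case False
          then show ?thesis by (simp add: \<xi>_def mod_Suc div_Suc)
        qed
        then show ?thesis using blk_R[OF s r] by (simp add: \<xi>_def)
      qed
      ultimately show ?thesis using R by (auto simp: full_shift_def)
    qed
    define z where "z = \<pi> (\<xi> (\<lambda>_. u0))"
    \<comment> \<open>All words in \<open>B a b\<close> have the same image and the connector is
      shared, so the image does not see which words were chosen.\<close>
    have \<xi>z: "\<pi> (\<xi> s) = z" if s: "\<And>j. s j \<in> B a b" for s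
    proof
      fix i
      have "\<Phi> (blk u r) = \<Phi> (blk u0 r)" if "u \<in> B a b" for u r
      proof (cases "r < n")
        case True
        then have "\<pi> (peak u) r = \<pi> (peak u0) r"
          using B(3)[OF that] B(3)[OF u0] by (simp add: prefix_word_eq_iff)
        then show ?thesis using True factor_symbol B(1)[OF that] B(1)[OF u0] by (simp add: blk_def)
      qed (simp add: blk_def)
      then show "\<pi> (\<xi> s) i = z i"
        using factor_symbol \<xi>X[OF s] \<xi>X[of "\<lambda>_. u0", OF u0] s by (simp add: z_def \<xi>_def)
    qed
    have zi: "z i = \<Phi> (blk u0 (i mod L))" for i
      using factor_symbol \<xi>X[of "\<lambda>_. u0", OF u0] by (simp add: z_def \<xi>_def)
    have zY: "z \<in> Y" unfolding z_def by (intro factor_Y \<xi>X u0)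
    have z_prefix: "prefix_word n z = prefix_word n y"
    proof -
      have "z i = y i" if "i < n" for i
      proof -
        have "z i = \<pi> (peak u0) i" using zi that L B(1)[OF u0] by (simp add: blk_def factor_symbol)
        then show ?thesis using B(3)[OF u0] that by (simp add: prefix_word_eq_iff)
      qed
      then show ?thesis by (simp add: prefix_word_eq_iff)
    qed
    have z_per: "(left_shift ^^ L) z = z" by (rule ext) (simp add: funpow_left_shift zi)
    have "(exp (- (v n + real p * M)) * (g n y / real k ^ 2)) ^ N \<le> g (N * L) z" for N
    proof -
      define S where "S = PiE {..<N} (\<lambda>_. B a b)"
      have finB: "finite (B a b)" using finite_fibre_words by (simp add: B_def)
      \<comment> \<open>Elements of \<open>S\<close> are \<open>undefined\<close> from
        \<open>N\<close> on; filling up with \<open>u0\<close> yields a genuine point of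
        \<open>X\<close>.\<close>
      define ext where "ext s j = (if j < N then s j else u0)" for s j
      have ext: "ext s j \<in> B a b" if "s \<in> S" for s j
        using that u0 by (auto simp: ext_def S_def)
      have \<xi>_block: "prefix_word n ((left_shift ^^ (j * L)) (\<xi> s)) = s j" if "\<And>j. s j \<in> B a b" for s j
      proof -
        have "prefix_word n ((left_shift ^^ (j * L)) (\<xi> s)) = prefix_word n (peak (s j))"
          using L by (auto simp: prefix_word_eq_iff funpow_left_shift \<xi>_def blk_def)
        then show ?thesis using B(2)[OF that] by simp
      qed
      have inj: "inj_on (\<lambda>s. prefix_word (N * L) (\<xi> (ext s))) S"
      proof (rule inj_onI)
        fix s t assume st: "s \<in> S" "t \<in> S"
          and eq: "prefix_word (N * L) (\<xi> (ext s)) = prefix_word (N * L) (\<xi> (ext t))"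
        have "s j = t j" if j: "j < N" for j
        proof -
          have "i + j * L < N * L" if "i < n" for i
          proof -
            have "i + j * L < Suc j * L" using that L by simp
            also have "\<dots> \<le> N * L" using j by (intro mult_le_mono1) simp
            finally show ?thesis .
          qed
          then have "prefix_word n ((left_shift ^^ (j * L)) (\<xi> (ext s)))
              = prefix_word n ((left_shift ^^ (j * L)) (\<xi> (ext t)))"
            using eq by (simp add: prefix_word_eq_iff funpow_left_shift)
          then have "ext s j = ext t j" using \<xi>_block[OF ext] st by simp
          then show ?thesis using j by (simp add: ext_def)
        qed
        then show "s = t" using st unfolding S_def by (intro PiE_ext) auto
      qed
      \<comment> \<open>Replacing the peak by another point with the same prefix costs
        \<open>v n\<close>, and the connector costs at most \<open>p * M\<close>.\<close>
      have block_le: "exp (- (v n + real p * M)) * weight u \<le> exp (birkhoff_sum f L x)"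
        if u: "u \<in> B a b" and x: "x \<in> X" "prefix_word n x = u" for u x
      proof -
        have "\<bar>birkhoff_sum f n x - birkhoff_sum f n (peak u)\<bar> \<le> v n"
          by (rule v) (use x B[OF u] in auto)
        moreover have "\<bar>birkhoff_sum f Q ((left_shift ^^ n) x)\<bar> \<le> real Q * M"
          using birkhoff_sum_abs_le[OF X M(2) shift_X[OF x(1)]] .
        moreover have "real Q * M \<le> real p * M" using Q M(1) by (intro mult_right_mono) auto
        ultimately have "- (v n + real p * M) + birkhoff_sum f n (peak u) \<le> birkhoff_sum f L x"
          unfolding L_def birkhoff_sum_add by linarith
        then show ?thesis using B(6)[OF u] by (simp add: weight_def exp_add[symmetric])
      qed
      have "(exp (- (v n + real p * M)) * (g n y / real k ^ 2)) ^ N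
          \<le> (\<Sum>u\<in>B a b. exp (- (v n + real p * M)) * weight u) ^ N"
        unfolding sum_distrib_left[symmetric]
        by (intro power_mono mult_left_mono ab) (use less_imp_le[OF fibre_sum_pos[OF y]] in auto)
      also have "\<dots> = (\<Prod>j<N. \<Sum>u\<in>B a b. exp (- (v n + real p * M)) * weight u)" by simp
      \<comment> \<open>Expanding the power produces one term for each choice of \<open>N\<close>
        words; distinct choices have distinct concatenations, all lying over
        \<open>z\<close>.\<close>
      also have "\<dots> = (\<Sum>s\<in>S. \<Prod>j<N. exp (- (v n + real p * M)) * weight (s j))"
        unfolding S_def by (rule prod_sum_PiE) (use finB in auto)
      also have "\<dots> \<le> (\<Sum>s\<in>S. exp (birkhoff_sum f (N * L) (\<xi> (ext s))))"
      proof (rule sum_mono)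
        fix s assume s: "s \<in> S"
        have "(\<Prod>j<N. exp (- (v n + real p * M)) * weight (s j))
            \<le> (\<Prod>j<N. exp (birkhoff_sum f L ((left_shift ^^ (j * L)) (\<xi> (ext s)))))"
        proof (rule prod_mono, rule conjI)
          fix j assume j: "j \<in> {..<N}"
          then have sj: "ext s j = s j" by (simp add: ext_def)
          show "exp (- (v n + real p * M)) * weight (s j)
              \<le> exp (birkhoff_sum f L ((left_shift ^^ (j * L)) (\<xi> (ext s))))"
          proof (rule block_le)
            show "s j \<in> B a b" using ext[OF s, of j] sj by simp
            show "(left_shift ^^ (j * L)) (\<xi> (ext s)) \<in> X" by (intro shift_X \<xi>X ext s)
            show "prefix_word n ((left_shift ^^ (j * L)) (\<xi> (ext s))) = s j"
              using \<xi>_block[OF ext[OF s], of j] sj by simp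
          qed
        qed (simp add: weight_def)
        also have "\<dots> = exp (birkhoff_sum f (N * L) (\<xi> (ext s)))"
          by (simp add: birkhoff_sum_blocks exp_sum)
        finally show "(\<Prod>j<N. exp (- (v n + real p * M)) * weight (s j))
            \<le> exp (birkhoff_sum f (N * L) (\<xi> (ext s)))" .
      qed
      also have "\<dots> \<le> g (N * L) z"
        unfolding fibre_sum_eq
      proof (rule sum_injection_le_weight[OF _ inj])
        show "finite S" unfolding S_def by (intro finite_PiE) (use finB in auto)
        fix s assume s: "s \<in> S"
        show "\<xi> (ext s) \<in> X" by (intro \<xi>X ext s)
        show "prefix_word (N * L) (\<pi> (\<xi> (ext s))) = prefix_word (N * L) z"
          using \<xi>z[OF ext[OF s]] by simp
      qed
      finally show ?thesis .
    qed
    then show ?thesis using zY Q z_prefix z_per unfolding L_def by blast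
  qed
  then show ?thesis using that by blast
qed

end

section \<open>Averages along periodic orbits\<close>

text \<open>The measure is the image of the uniform distribution on the indices below
  \<open>L\<close>. Weighting indices instead of points covers the case that \<open>L\<close> is a
  proper multiple of the least period.\<close>

lemma periodic_orbit_measure:
  assumes Y: "subshift l Y" and z: "z \<in> Y" and L: "0 < L" and per: "(left_shift ^^ L) z = z"
  obtains m where "m \<in> invariant_measures Y"
    "\<And>\<phi> :: _ \<Rightarrow> real. \<phi> \<in> borel_measurable (restrict_space borel Y) \<Longrightarrow>
       (\<integral>y. \<phi> y \<partial>m) = (\<Sum>i<L. \<phi> ((left_shift ^^ i) z)) / real L"
proof -
  let ?Q = "restrict_space borel Y"
  let ?u = "pmf_of_set {..<L}"
  define orb where "orb i = (left_shift ^^ i) z" for i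
  define m where "m = distr (measure_pmf ?u) ?Q orb"
  have space_Q: "space ?Q = Y" by (simp add: space_restrict_space)
  have orb: "orb \<in> measurable (measure_pmf ?u) ?Q"
    using subshift_funpow[OF Y z] by (auto simp: orb_def space_Q)
  have shift_Q: "left_shift \<in> measurable ?Q ?Q"
    using borel_measurable_continuous_on_restrict[OF continuous_on_left_shift] Y
    by (intro measurable_restrict_space2) (auto simp: space_Q subshift_def)
  \<comment> \<open>On indices the shift acts as the cyclic successor, a permutation that preserves
    the uniform distribution; this gives invariance.\<close>
  define \<tau> where "\<tau> i = Suc i mod L" for i
  have "bij_betw \<tau> {..<L} {..<L}"
  proof (rule bij_betw_byWitness[of _ "\<lambda>i. (i + L - 1) mod L"])
    show "\<forall>i\<in>{..<L}. (\<tau> i + L - 1) mod L = i"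
      using L by (auto simp: \<tau>_def mod_Suc)
    show "\<forall>i\<in>{..<L}. \<tau> ((i + L - 1) mod L) = i"
      using L by (auto simp: \<tau>_def mod_Suc_eq)
  qed (use L in \<open>auto simp: \<tau>_def\<close>)
  then have \<tau>: "map_pmf \<tau> ?u = ?u"
    by (rule map_pmf_of_set_bij_betw) (use L in auto)
  have orb_\<tau>: "left_shift (orb i) = orb (\<tau> i)" for i
  proof -
    have "(left_shift ^^ (L * j)) z = z" for j
      by (induction j) (simp_all add: funpow_add per)
    then have "(left_shift ^^ (Suc i mod L + L * (Suc i div L))) z = (left_shift ^^ (Suc i mod L)) z"
      by (subst funpow_add) simp
    then show ?thesis by (simp add: orb_def \<tau>_def del: mod_mult_div_eq)
  qed
  have "distr m m left_shift = distr m ?Q left_shift" by (rule distr_cong) (auto simp: m_def)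
  also have "\<dots> = distr (measure_pmf ?u) ?Q (left_shift \<circ> orb)"
    unfolding m_def by (rule distr_distr[OF shift_Q orb])
  also have "left_shift \<circ> orb = orb \<circ> \<tau>" using orb_\<tau> by auto
  also have "distr (measure_pmf ?u) ?Q (orb \<circ> \<tau>) = distr (distr (measure_pmf ?u) (count_space UNIV) \<tau>) ?Q orb"
    by (rule distr_distr[symmetric]) (use subshift_funpow[OF Y z] in \<open>auto simp: orb_def space_Q\<close>)
  also have "\<dots> = m" unfolding map_pmf_rep_eq[symmetric] \<tau> m_def ..
  finally have "distr m m left_shift = m" .
  moreover have "prob_space m"
    unfolding m_def by (rule measure_pmf.prob_space_distr[OF orb])
  ultimately have "m \<in> invariant_measures Y"
    by (simp add: invariant_measures_def m_def)
  moreover have "(\<integral>y. \<phi> y \<partial>m) = (\<Sum>i<L. \<phi> ((left_shift ^^ i) z)) / real L"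
    if "\<phi> \<in> borel_measurable ?Q" for \<phi> :: "_ \<Rightarrow> real"
    unfolding m_def integral_distr[OF orb that] orb_def
    using L by (subst integral_pmf_of_set) auto
  ultimately show ?thesis using that by blast
qed

text \<open>The upper and lower bounds for the averaged logarithms are affine in \<open>N\<close>,
  so only their slopes survive the limit.\<close>

lemma linear_ratio_limit:
  assumes "0 < L"
  shows "(\<lambda>N. (real N * a + b) / real (Suc N * L)) \<longlonglongrightarrow> a / real L"
proof -
  have "(\<lambda>N. (real N * a + b) / real (Suc N * L)) \<longlonglongrightarrow> a * inverse (real L)"
    using assms by real_asymp
  then show ?thesis by (simp only: divide_inverse)
qed

context one_block_factor
begin

text \<open>The orbit measure averages \<open>ln g\<close> over the starting points of the orbit.
  Each of these is compared with the values at \<open>z\<close> itself at a cost independent of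
  \<open>N\<close>, which disappears after division by the length.\<close>

lemma periodic_squeeze:
  assumes h: "continuous_on Y h"
    and lim: "\<forall>m\<in>invariant_measures Y. (\<lambda>n. 1 / real n * (\<integral>y. ln (g n y) \<partial>m)) \<longlonglongrightarrow> (\<integral>y. h y \<partial>m)"
    and z: "z \<in> Y" "0 < L" "(left_shift ^^ L) z = z"
    and low: "0 < b" "\<And>N. b ^ N \<le> g (N * L) z"
  shows "ln b \<le> birkhoff_sum h L z" "birkhoff_sum h L z \<le> ln (g L z)"
proof -
  obtain M where M: "0 \<le> M" "\<forall>x\<in>X. \<bar>f x\<bar> \<le> M" using subshift_bounded[OF X cont] .
  define K where "K = real k * exp M"
  have "1 \<le> real k" "1 \<le> exp M" using k_pos M(1) by auto
  then have K: "1 \<le> K" using mult_mono[of 1 "real k" 1 "exp M"] by (simp add: K_def)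
  have gK: "g n y \<le> K ^ n" for n y unfolding K_def by (rule fibre_sum_le_power[OF M(2)])
  have gz: "0 < g n ((left_shift ^^ i) z)" for n i using fibre_sum_pos[OF shift_Y[OF z(1)]] .
  have gz0: "0 < g n z" for n using fibre_sum_pos[OF z(1)] .
  have g0: "0 \<le> g n y" for n y
    unfolding fibre_sum_eq by (rule sum_nonneg) (simp add: weight_def)
  have per: "(left_shift ^^ (N * L)) z = z" for N
    by (induction N) (simp_all add: funpow_add z(3))
  have power_le: "g (N * L) z \<le> g L z ^ N" if "0 < N" for N
    using that
  proof (induction N rule: nat_induct_non_zero)
    case (Suc N)
    have "g (Suc N * L) z = g (N * L + L) z" by (simp add: add.commute)
    also have "\<dots> \<le> g (N * L) z * g L z" using fibre_sum_submult[of "N * L" L z] per by simp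
    also have "\<dots> \<le> g L z ^ N * g L z" using Suc g0 by (intro mult_right_mono) auto
    finally show ?case by (simp add: mult.commute)
  qed simp
  have KL: "1 \<le> K ^ L" using K by (rule one_le_power)
  have up: "g (N * L) z \<le> K ^ L * g L z ^ N" for N
  proof (cases "N = 0")
    case True
    then show ?thesis using order_trans[OF gK[of 0 z]] KL by simp
  next
    case False
    then have "g (N * L) z \<le> 1 * g L z ^ N" using power_le by simp
    also have "\<dots> \<le> K ^ L * g L z ^ N" using KL g0 by (intro mult_right_mono) simp_all
    finally show ?thesis .
  qed
  \<comment> \<open>Starting \<open>i\<close> steps into the orbit, a stretch of length
    \<open>Suc N * L\<close> consists of \<open>L - i\<close> steps back to \<open>z\<close>, then
    \<open>N\<close> full periods, then \<open>i\<close> further steps.\<close>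
  have upper: "ln (g (Suc N * L) ((left_shift ^^ i) z)) \<le> real N * ln (g L z) + 2 * real L * ln K"
    if i: "i < L" for N i
  proof -
    have "(left_shift ^^ (L - i)) ((left_shift ^^ i) z) = (left_shift ^^ L) z"
      using i by (metis comp_apply funpow_add le_add_diff_inverse2 less_imp_le)
    then have 1: "(left_shift ^^ (L - i)) ((left_shift ^^ i) z) = z" by (simp add: z(3))
    have "g (Suc N * L) ((left_shift ^^ i) z) = g ((L - i) + (N * L + i)) ((left_shift ^^ i) z)"
      using i by simp
    also have "\<dots> \<le> g (L - i) ((left_shift ^^ i) z) * g (N * L + i) z"
      using fibre_sum_submult[of "L - i" "N * L + i" "(left_shift ^^ i) z"] 1 by simp
    also have "\<dots> \<le> K ^ (L - i) * (g (N * L) z * g i z)"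
      using fibre_sum_submult[of "N * L" i z] per by (intro mult_mono gK g0) (use K in auto)
    also have "\<dots> \<le> K ^ (L - i) * ((K ^ L * g L z ^ N) * K ^ i)"
      by (intro mult_left_mono mult_mono up gK g0 mult_nonneg_nonneg zero_le_power) (use K in auto)
    also have "\<dots> = K ^ (L - i + i) * K ^ L * g L z ^ N" by (simp only: power_add) simp
    also have "\<dots> = K ^ (2 * L) * g L z ^ N" using i by (simp add: power_add[symmetric] mult_2)
    finally have "ln (g (Suc N * L) ((left_shift ^^ i) z)) \<le> ln (K ^ (2 * L) * g L z ^ N)"
      using gz by (subst ln_le_cancel_iff) (use K gz0[of L] in auto)
    also have "\<dots> = real N * ln (g L z) + 2 * real L * ln K"
      using K gz0[of L] by (simp add: ln_mult ln_realpow)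
    finally show ?thesis .
  qed
  \<comment> \<open>Conversely, that stretch sits inside \<open>N + 2\<close> full periods from
    \<open>z\<close>, preceded by \<open>i\<close> and followed by \<open>L - i\<close>
    steps.\<close>
  have lower: "real N * ln b + (2 * ln b - real L * ln K) \<le> ln (g (Suc N * L) ((left_shift ^^ i) z))"
    if i: "i < L" for N i
  proof -
    have "b ^ (N + 2) \<le> g (i + (Suc N * L + (L - i))) z"
      using low(2)[of "N + 2"] i by (simp add: algebra_simps)
    also have "\<dots> \<le> g i z * g (Suc N * L + (L - i)) ((left_shift ^^ i) z)"
      by (rule fibre_sum_submult)
    also have "\<dots> \<le> K ^ i * (g (Suc N * L) ((left_shift ^^ i) z) * K ^ (L - i))"
      by (intro mult_mono gK g0 order_trans[OF fibre_sum_submult] order.refl) (use K in auto)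
    also have "\<dots> = K ^ (i + (L - i)) * g (Suc N * L) ((left_shift ^^ i) z)"
      by (simp only: power_add) simp
    finally have "b ^ (N + 2) \<le> K ^ L * g (Suc N * L) ((left_shift ^^ i) z)" using i by simp
    then have "ln (b ^ (N + 2)) \<le> ln (K ^ L * g (Suc N * L) ((left_shift ^^ i) z))"
      using low(1) by (subst ln_le_cancel_iff) (use K gz in auto)
    then have "real (N + 2) * ln b \<le> real L * ln K + ln (g (Suc N * L) ((left_shift ^^ i) z))"
      using low(1) K gz[of "Suc N * L" i] by (simp add: ln_mult ln_realpow distrib_right del: mult_Suc)
    then show ?thesis by (simp add: algebra_simps)
  qed
  obtain m where m: "m \<in> invariant_measures Y"
    and int: "\<And>\<phi> :: _ \<Rightarrow> real. \<phi> \<in> borel_measurable (restrict_space borel Y) \<Longrightarrow>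
       (\<integral>y. \<phi> y \<partial>m) = (\<Sum>i<L. \<phi> ((left_shift ^^ i) z)) / real L"
    using periodic_orbit_measure[OF Y z] by blast
  have int_h: "(\<integral>y. h y \<partial>m) = birkhoff_sum h L z / real L"
    using int[OF borel_measurable_continuous_on_restrict[OF h]] by (simp add: birkhoff_sum_def)
  define a where "a N = (\<Sum>i<L. ln (g (Suc N * L) ((left_shift ^^ i) z))) / real L" for N
  have "(\<lambda>n. 1 / real n * (\<integral>y. ln (g n y) \<partial>m)) \<longlonglongrightarrow> birkhoff_sum h L z / real L"
    using lim m int_h by metis
  moreover have "strict_mono (\<lambda>N. Suc N * L)" using z(2) by (intro strict_monoI) simp
  ultimately have "((\<lambda>n. 1 / real n * (\<integral>y. ln (g n y) \<partial>m)) \<circ> (\<lambda>N. Suc N * L))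
      \<longlonglongrightarrow> birkhoff_sum h L z / real L" by (rule LIMSEQ_subseq_LIMSEQ)
  then have a_lim: "(\<lambda>N. a N / real (Suc N * L)) \<longlonglongrightarrow> birkhoff_sum h L z / real L"
    unfolding int[OF fibre_sum_measurable] a_def comp_def by (simp add: mult.commute)
  have a_low: "real N * ln b + (2 * ln b - real L * ln K) \<le> a N" for N
  proof -
    have "(\<Sum>i<L. real N * ln b + (2 * ln b - real L * ln K)) / real L \<le> a N"
      unfolding a_def by (intro divide_right_mono sum_mono lower) auto
    then show ?thesis using z(2) by simp
  qed
  have a_up: "a N \<le> real N * ln (g L z) + 2 * real L * ln K" for N
  proof -
    have "a N \<le> (\<Sum>i<L. real N * ln (g L z) + 2 * real L * ln K) / real L"
      unfolding a_def by (intro divide_right_mono sum_mono upper) auto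
    then show ?thesis using z(2) by simp
  qed
  have "ln b / real L \<le> birkhoff_sum h L z / real L"
    by (rule LIMSEQ_le[OF linear_ratio_limit[OF z(2), of _ "2 * ln b - real L * ln K"] a_lim])
      (intro exI[of _ 0] allI impI divide_right_mono a_low of_nat_0_le_iff)
  then show "ln b \<le> birkhoff_sum h L z" using z(2) by (simp add: divide_le_cancel)
  have "birkhoff_sum h L z / real L \<le> ln (g L z) / real L"
    by (rule LIMSEQ_le[OF a_lim linear_ratio_limit[OF z(2), of _ "2 * real L * ln K"]])
      (intro exI[of _ 0] allI impI divide_right_mono a_up of_nat_0_le_iff)
  then show "birkhoff_sum h L z \<le> ln (g L z)" using z(2) by (simp add: divide_le_cancel)
qed

text \<open>The periodic point that shadows \<open>y\<close> agrees with it on \<open>n\<close>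
  symbols and has only a bounded number of further symbols per period. The squeeze on its Birkhoff
  sum therefore transfers to \<open>y\<close> with error \<open>o(n)\<close>.\<close>

lemma almost_multiplicative_if_integrals:
  assumes sft: "one_step_sft k X" and irr: "irreducible_shift X"
    and h: "continuous_on Y h"
    and lim: "\<forall>m\<in>invariant_measures Y. (\<lambda>n. 1 / real n * (\<integral>y. ln (g n y) \<partial>m)) \<longlonglongrightarrow> (\<integral>y. h y \<partial>m)"
  shows "\<exists>C. almost_multiplicative Y g C"
proof -
  obtain M where M: "0 \<le> M" "\<forall>x\<in>X. \<bar>f x\<bar> \<le> M" using subshift_bounded[OF X cont] .
  obtain H where H: "0 \<le> H" "\<forall>y\<in>Y. \<bar>h y\<bar> \<le> H" using subshift_bounded[OF Y h] .
  obtain v where v: "(\<lambda>n. v n / real n) \<longlonglongrightarrow> 0" "\<And>n. 0 \<le> v n"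
    "\<And>n x x'. x \<in> X \<Longrightarrow> x' \<in> X \<Longrightarrow> prefix_word n x = prefix_word n x' \<Longrightarrow>
       \<bar>birkhoff_sum f n x - birkhoff_sum f n x'\<bar> \<le> v n"
    using birkhoff_sum_distortion[OF X cont] by blast
  obtain w where w: "(\<lambda>n. w n / real n) \<longlonglongrightarrow> 0" "\<And>n. 0 \<le> w n"
    "\<And>n x x'. x \<in> Y \<Longrightarrow> x' \<in> Y \<Longrightarrow> prefix_word n x = prefix_word n x' \<Longrightarrow>
       \<bar>birkhoff_sum h n x - birkhoff_sum h n x'\<bar> \<le> w n"
    using birkhoff_sum_distortion[OF Y h] by blast
  obtain p where p: "\<And>n y. 1 \<le> n \<Longrightarrow> y \<in> Y \<Longrightarrow> \<exists>z q. z \<in> Y \<and> q \<le> p \<and>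
    prefix_word n z = prefix_word n y \<and> (left_shift ^^ (n + q)) z = z \<and>
    (\<forall>N. (exp (- (v n + real p * M)) * (g n y / real k ^ 2)) ^ N \<le> g (N * (n + q)) z)"
    using closing[OF sft irr M v(3)] by blast
  define K where "K = real k * exp M"
  have "1 \<le> real k" "1 \<le> exp M" using k_pos M(1) by auto
  then have K: "1 \<le> K" using mult_mono[of 1 "real k" 1 "exp M"] by (simp add: K_def)
  \<comment> \<open>The first two terms come from the base of the closing bound,
    \<open>real p * ln K\<close> from the growth of \<open>g\<close> over the gap, and
    \<open>real p * H\<close> from the sum of \<open>h\<close> over the gap.\<close>
  define c where "c = real p * M + 2 * ln (real k) + real p * ln K + real p * H"
  define e where "e n = v n + w n + c" for n
  have bound: "\<bar>ln (g n y) - birkhoff_sum h n y\<bar> \<le> e n" if n: "1 \<le> n" and y: "y \<in> Y" for n y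
  proof -
    obtain z q where z: "z \<in> Y" and q: "q \<le> p" and pre: "prefix_word n z = prefix_word n y"
      and per: "(left_shift ^^ (n + q)) z = z"
      and low: "\<And>N. (exp (- (v n + real p * M)) * (g n y / real k ^ 2)) ^ N \<le> g (N * (n + q)) z"
      using p[OF n y] by blast
    let ?b = "exp (- (v n + real p * M)) * (g n y / real k ^ 2)"
    have gy: "0 < g n y" by (rule fibre_sum_pos[OF y])
    have b: "0 < ?b" using gy k_pos by simp
    have L: "0 < n + q" using n by simp
    note sq = periodic_squeeze[OF h lim z L per b low]
    have ln_b: "ln ?b = ln (g n y) - v n - real p * M - 2 * ln (real k)"
      using gy k_pos by (simp add: ln_mult ln_div ln_realpow)
    have "g n z = g n y" by (simp add: fibre_sum_eq fibre_words_def pre)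
    then have "g (n + q) z \<le> g n y * g q ((left_shift ^^ n) z)"
      using fibre_sum_submult[of n q z] by simp
    also have "\<dots> \<le> g n y * K ^ q"
      unfolding K_def by (intro mult_left_mono fibre_sum_le_power[OF M(2)] less_imp_le[OF gy])
    finally have "ln (g (n + q) z) \<le> ln (g n y * K ^ q)"
      using fibre_sum_pos[OF z] by (subst ln_le_cancel_iff) (use gy K in auto)
    also have "\<dots> = ln (g n y) + real q * ln K" using gy K by (simp add: ln_mult ln_realpow)
    also have "\<dots> \<le> ln (g n y) + real p * ln K" using q K by (simp add: mult_right_mono)
    finally have up: "ln (g (n + q) z) \<le> ln (g n y) + real p * ln K" .
    have "\<bar>birkhoff_sum h n z - birkhoff_sum h n y\<bar> \<le> w n" by (rule w(3)[OF z y pre])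
    moreover have "\<bar>birkhoff_sum h q ((left_shift ^^ n) z)\<bar> \<le> real q * H"
      by (rule birkhoff_sum_abs_le[OF Y H(2) shift_Y[OF z]])
    moreover have "real q * H \<le> real p * H" using q H(1) by (intro mult_right_mono) auto
    ultimately have hz: "\<bar>birkhoff_sum h (n + q) z - birkhoff_sum h n y\<bar> \<le> w n + real p * H"
      unfolding birkhoff_sum_add by linarith
    have "0 \<le> real p * M" "0 \<le> ln (real k)" "0 \<le> real p * ln K" using M(1) k_pos K by auto
    then show ?thesis using sq ln_b up hz v(2)[of n] unfolding e_def c_def abs_le_iff by linarith
  qed
  have "(\<lambda>n. v n / real n + w n / real n + c / real n) \<longlonglongrightarrow> 0 + 0 + 0"
    by (intro tendsto_add v(1) w(1) lim_const_over_n)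
  then have lim_e: "(\<lambda>n. e n / real n) \<longlonglongrightarrow> 0" by (simp add: e_def add_divide_distrib)
  show ?thesis
    by (rule almost_multiplicative_if_birkhoff_approx[OF fibre_sum_pos shift_Y bound lim_e])
qed

section \<open>The image of a weak Gibbs measure\<close>

lemma cylinder_sets: "cylinder Z u \<in> sets (restrict_space borel Z)"
proof -
  have "cylinder Z u = Z \<inter> {z. prefix_word (length u) z = u}" by (auto simp: cylinder_def)
  then show ?thesis using borel_prefix by (auto simp: sets_restrict_space)
qed

text \<open>The preimage of a cylinder of \<open>Y\<close> is the disjoint union of the cylinders of
  its fibre words.\<close>

lemma measure_cylinder_factor:
  assumes \<mu>: "\<mu> \<in> invariant_measures X"
  shows "measure (distr \<mu> (restrict_space borel Y) \<pi>) (cylinder Y (prefix_word n y))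
    = (\<Sum>u\<in>fibre_words X \<Phi> n y. measure \<mu> (cylinder X u))"
proof -
  interpret prob_space \<mu> using \<mu> by (simp add: invariant_measures_def)
  have sets: "sets \<mu> = sets (restrict_space borel X)" using \<mu> by (simp add: invariant_measures_def)
  then have space: "space \<mu> = X" using sets_eq_imp_space_eq[OF sets] by (simp add: space_restrict_space)
  have "\<pi> \<in> measurable (restrict_space borel X) (restrict_space borel Y)"
    using factor borel_measurable_continuous_on_restrict[of X \<pi>]
    by (intro measurable_restrict_space2) (auto simp: space_restrict_space factor_map_def)
  then have meas: "\<pi> \<in> measurable \<mu> (restrict_space borel Y)"
    using measurable_cong_sets[OF sets refl] by blast
  have cyl: "x \<in> cylinder X u \<longleftrightarrow> x \<in> X \<and> prefix_word n x = u"
    if "u \<in> fibre_words X \<Phi> n y" for x u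
    using length_fibre_word[OF that] by (simp add: cylinder_def)
  have "(\<Union>u\<in>fibre_words X \<Phi> n y. cylinder X u)
      = {x \<in> X. prefix_word n x \<in> fibre_words X \<Phi> n y}"
    by (rule set_eqI) (metis (no_types, lifting) UN_iff cyl mem_Collect_eq)
  also have "\<dots> = \<pi> -` cylinder Y (prefix_word n y) \<inter> space \<mu>"
    using factor_Y by (auto simp: prefix_mem_fibre_words space cylinder_def)
  finally have pre: "\<pi> -` cylinder Y (prefix_word n y) \<inter> space \<mu>
      = (\<Union>u\<in>fibre_words X \<Phi> n y. cylinder X u)" ..
  have "measure \<mu> (\<Union>u\<in>fibre_words X \<Phi> n y. cylinder X u)
      = (\<Sum>u\<in>fibre_words X \<Phi> n y. measure \<mu> (cylinder X u))"
  proof (rule finite_measure_finite_Union[OF finite_fibre_words])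
    show "disjoint_family_on (cylinder X) (fibre_words X \<Phi> n y)"
      using cyl by (auto simp: disjoint_family_on_def)
  qed (use cylinder_sets sets in auto)
  then show ?thesis using measure_distr[OF meas cylinder_sets] pre by simp
qed

text \<open>Summing the bounds for \<open>\<mu>\<close> over a fibre compares the image measure of a
  cylinder with \<open>g n y\<close>; the bounds for the image measure compare it with the Birkhoff
  sum of \<open>h\<close>.\<close>

lemma almost_multiplicative_if_weak_gibbs:
  assumes \<mu>: "invariant_weak_gibbs X f \<mu>"
    and \<nu>: "invariant_weak_gibbs Y h (distr \<mu> (restrict_space borel Y) \<pi>)"
  shows "\<exists>C. almost_multiplicative Y g C"
proof -
  let ?\<nu> = "distr \<mu> (restrict_space borel Y) \<pi>"
  define P P' where "P = pressure X f" and "P' = pressure Y h"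
  obtain C where C: "\<forall>n\<ge>1. 0 < C n" "(\<lambda>n. 1 / real n * ln (C n)) \<longlonglongrightarrow> 0"
    "\<forall>x\<in>X. \<forall>n\<ge>1. 1 / C n < measure \<mu> (cylinder X (prefix_word n x)) /
        exp (- real n * P + birkhoff_sum f n x) \<and>
      measure \<mu> (cylinder X (prefix_word n x)) / exp (- real n * P + birkhoff_sum f n x) < C n"
    and inv: "\<mu> \<in> invariant_measures X"
    using \<mu> unfolding invariant_weak_gibbs_def P_def by blast
  obtain D where D: "\<forall>n\<ge>1. 0 < D n" "(\<lambda>n. 1 / real n * ln (D n)) \<longlonglongrightarrow> 0"
    "\<forall>y\<in>Y. \<forall>n\<ge>1. 1 / D n < measure ?\<nu> (cylinder Y (prefix_word n y)) /
        exp (- real n * P' + birkhoff_sum h n y) \<and>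
      measure ?\<nu> (cylinder Y (prefix_word n y)) / exp (- real n * P' + birkhoff_sum h n y) < D n"
    using \<nu> unfolding invariant_weak_gibbs_def P'_def by blast
  define e where "e n = ln (C n) + ln (D n)" for n
  \<comment> \<open>Adding the constant \<open>P - P'\<close> to \<open>h\<close> absorbs the two
    pressure normalisations.\<close>
  have bound: "\<bar>ln (g n y) - birkhoff_sum (\<lambda>y. h y + (P - P')) n y\<bar> \<le> e n"
    if n: "1 \<le> n" and y: "y \<in> Y" for n y
  proof -
    let ?U = "fibre_words X \<Phi> n y"
    define q where "q = measure ?\<nu> (cylinder Y (prefix_word n y))"
    have q_eq: "q = (\<Sum>u\<in>?U. measure \<mu> (cylinder X u))"
      unfolding q_def by (rule measure_cylinder_factor[OF inv])
    have Cn: "0 < C n" and Dn: "0 < D n" using C(1) D(1) n by auto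
    have gy: "0 < g n y" by (rule fibre_sum_pos[OF y])
    \<comment> \<open>The Gibbs inequality is evaluated at the peak of \<open>u\<close>, where the
      exponential of the Birkhoff sum is exactly \<open>weight u\<close>.\<close>
    have u: "exp (- real n * P) / C n * weight u \<le> measure \<mu> (cylinder X u)"
      "measure \<mu> (cylinder X u) \<le> exp (- real n * P) * C n * weight u" if u: "u \<in> ?U" for u
    proof -
      have w: "exp (- real n * P + birkhoff_sum f n (peak u)) = exp (- real n * P) * weight u"
        unfolding weight_def length_fibre_word[OF u] by (rule exp_add)
      have "1 / C n < measure \<mu> (cylinder X u) / (exp (- real n * P) * weight u)"
        "measure \<mu> (cylinder X u) / (exp (- real n * P) * weight u) < C n"
        using C(3)[rule_format, OF peak_fibre_word(1)[OF u] n] unfolding w peak_fibre_word(2)[OF u]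
        by auto
      moreover have "0 < exp (- real n * P) * weight u" by (simp add: weight_pos)
      ultimately show "exp (- real n * P) / C n * weight u \<le> measure \<mu> (cylinder X u)"
        "measure \<mu> (cylinder X u) \<le> exp (- real n * P) * C n * weight u"
        using Cn by (simp_all add: field_simps)
    qed
    have q1: "exp (- real n * P) / C n * g n y \<le> q" "q \<le> exp (- real n * P) * C n * g n y"
      unfolding q_eq fibre_sum_eq sum_distrib_left by (intro sum_mono u; assumption)+
    have q0: "0 < q" by (rule less_le_trans[OF _ q1(1)]) (use gy Cn in simp)
    have "ln (exp (- real n * P) / C n * g n y) \<le> ln q" "ln q \<le> ln (exp (- real n * P) * C n * g n y)"
      using q1 q0 gy Cn by auto
    then have q2: "- real n * P - ln (C n) + ln (g n y) \<le> ln q"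
      "ln q \<le> - real n * P + ln (C n) + ln (g n y)"
      using gy Cn by (simp_all add: ln_mult ln_div)
    define s where "s = - real n * P' + birkhoff_sum h n y"
    have "1 / D n < q / exp s" "q / exp s < D n"
      using D(3)[rule_format, OF y n] unfolding q_def s_def by auto
    then have "ln (1 / D n) < ln (q / exp s)" "ln (q / exp s) < ln (D n)"
      using q0 Dn by auto
    then have q3: "- ln (D n) < ln q - s" "ln q - s < ln (D n)"
      using q0 Dn by (simp_all add: ln_div)
    have "birkhoff_sum (\<lambda>y. h y + (P - P')) n y = birkhoff_sum h n y + real n * P - real n * P'"
      by (simp add: birkhoff_sum_def sum.distrib right_diff_distrib)
    then show ?thesis using q2 q3 unfolding s_def e_def abs_le_iff by linarith
  qed
  have "(\<lambda>n. 1 / real n * ln (C n) + 1 / real n * ln (D n)) \<longlonglongrightarrow> 0 + 0"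
    by (intro tendsto_add C(2) D(2))
  then have lim_e: "(\<lambda>n. e n / real n) \<longlonglongrightarrow> 0" by (simp add: e_def add_divide_distrib)
  show ?thesis
    by (rule almost_multiplicative_if_birkhoff_approx[OF fibre_sum_pos shift_Y bound lim_e])
qed

end

theorem corollary7p2:
  fixes k l :: nat
    and X Y :: "(nat \<Rightarrow> nat) set"
    and \<pi> :: "(nat \<Rightarrow> nat) \<Rightarrow> nat \<Rightarrow> nat"
    and \<Phi> :: "nat \<Rightarrow> nat"
    and f :: "(nat \<Rightarrow> nat) \<Rightarrow> real"
    and \<mu> :: "(nat \<Rightarrow> nat) measure"
  assumes "one_step_sft k X"
    and "irreducible_shift X"
    and "subshift l Y"
    and "factor_map X Y \<pi>"
    and "one_block_map X \<Phi> \<pi>"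
    and "continuous_on X f"
    and "invariant_weak_gibbs X f \<mu>"
    and "\<nexists>C. almost_multiplicative Y (fibre_sum X \<Phi> f) C"
  shows "(\<nexists>h. continuous_on Y h \<and>
            (\<forall>m \<in> invariant_measures Y.
               (\<lambda>n. 1 / real n * (\<integral>y. ln (fibre_sum X \<Phi> f n y) \<partial>m)) \<longlonglongrightarrow> (\<integral>y. h y \<partial>m)))
       \<and> (\<nexists>h. continuous_on Y h \<and>
            invariant_weak_gibbs Y h (distr \<mu> (restrict_space borel Y) \<pi>))"
proof -
  \<comment> \<open>Over an empty \<open>Y\<close> the constant sequence 1 would be almost
    multiplicative vacuously, contrary to the hypothesis.\<close>
  have "X \<noteq> {}"
  proof
    assume "X = {}"
    then have "Y = {}" using assms(4) by (simp add: factor_map_def)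
    then have "almost_multiplicative Y (fibre_sum X \<Phi> f) (\<lambda>_ _. 1)"
      by (simp add: almost_multiplicative_def)
    then show False using assms(8) by blast
  qed
  then interpret one_block_factor k l X Y \<pi> \<Phi> f
    using assms by unfold_locales (auto simp: one_step_sft_def)
  show ?thesis
    using assms(8) almost_multiplicative_if_integrals[OF assms(1,2)]
      almost_multiplicative_if_weak_gibbs[OF assms(7)]
    by (intro conjI notI; elim exE conjE) metis+
qed

end
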